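(* Fix $\tau$ in the upper half-plane and let $f(z|\tau)$ be an even entire function of $z$ satisfying $f(z|\tau)=f(z+\pi|\tau)=q^4 e^{16iz}f(z+\pi\tau|\tau)$ for all $z$. Then \begin{align*} &\frac{4f(\frac{2\pi}{5}|\tau)}{\theta_1^2(\frac{\pi}{5}|\tau)}-\frac{4f(\frac{\pi}{5}|\tau)}{\theta_1^2(\frac{2\pi}{5}|\tau)}\\ &=\frac{\sqrt{5}\eta^2(5\tau)}{\eta^4(\tau)}\left\{\frac{-f(0|\tau)\eta^3(\tau)}{5\eta^3(5\tau)}+\frac{f(\frac{\pi}{2}|\tau)\vartheta_2(\tau)}{\vartheta_2(5\tau)}-\frac{qf(\frac{\pi+\pi\tau}{2}|\tau)\vartheta_3(\tau)}{\vartheta_3(5\tau)}+\frac{qf(\frac{\pi\tau}{2}|\tau)\vartheta_4(\tau)}{\vartheta_4(5\tau)}\right\}. \end{align*}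
   Context: $q=e^{2\pi i\tau}$, $q^a=e^{2\pi i a\tau}$; $\eta(\tau)=q^{1/24}\prod_{n\ge1}(1-q^n)$; $\theta_1(z|\tau)=2\sum_{n\ge0}(-1)^nq^{(2n+1)^2/8}\sin(2n+1)z$; $\vartheta_2(\tau)=2\sum_{n\ge0}q^{(2n+1)^2/8}$, $\vartheta_3(\tau)=1+2\sum_{n\ge1}q^{n^2/2}$, $\vartheta_4(\tau)=1+2\sum_{n\ge1}(-1)^nq^{n^2/2}$. *)

theory Defs
  imports "HOL-Complex_Analysis.Complex_Analysis"
begin

(* Real powers of q = exp (2 pi i tau) are fixed by tau itself, not by a branch of the logarithm of q. *)
definition qpow :: "real \<Rightarrow> complex \<Rightarrow> complex" where
  "qpow a \<tau> = exp (2 * of_real pi * \<i> * of_real a * \<tau>)"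

(* Sums and products over n >= 1 are re-indexed by Suc n. *)
definition dedekind_eta :: "complex \<Rightarrow> complex" where
  "dedekind_eta \<tau> = qpow (1 / 24) \<tau> * (\<Prod>n. 1 - qpow (real (Suc n)) \<tau>)"

definition theta1 :: "complex \<Rightarrow> complex \<Rightarrow> complex" where
  "theta1 z \<tau> =
     2 * (\<Sum>n. (-1) ^ n * qpow ((2 * real n + 1)\<^sup>2 / 8) \<tau> * sin (of_nat (2 * n + 1) * z))"

definition vartheta2 :: "complex \<Rightarrow> complex" where
  "vartheta2 \<tau> = 2 * (\<Sum>n. qpow ((2 * real n + 1)\<^sup>2 / 8) \<tau>)"

definition vartheta3 :: "complex \<Rightarrow> complex" where
  "vartheta3 \<tau> = 1 + 2 * (\<Sum>n. qpow ((real (Suc n))\<^sup>2 / 2) \<tau>)"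

definition vartheta4 :: "complex \<Rightarrow> complex" where
  "vartheta4 \<tau> = 1 + 2 * (\<Sum>n. (-1) ^ Suc n * qpow ((real (Suc n))\<^sup>2 / 2) \<tau>)"

end

theory Submission
  imports Defs "HOL-Library.Nat_Bijection"
begin

text \<open>
  The function \<open>f(z) \<theta>\<^sub>1(z|\<tau>) / (\<theta>\<^sub>1(2z|\<tau>) \<theta>\<^sub>1(5z|5\<tau>))\<close> is elliptic with periods \<open>\<pi>\<close> and \<open>\<pi>\<tau>\<close>, and its
  poles are simple and located at the half periods and at \<open>k\<pi>/5\<close>. The theorem says that its residues
  add up to zero: by \<open>\<theta>\<^sub>1'(0) = 2\<eta>\<^sup>3\<close> and the values of \<open>\<theta>\<^sub>1\<close> at the half periods the residues there are the
  four terms in braces, the residues at \<open>\<plusminus>k\<pi>/5\<close> agree because the function is odd, and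
  \<open>\<theta>\<^sub>1(\<pi>/5) \<theta>\<^sub>1(2\<pi>/5) = \<surd>5 \<eta>(\<tau>) \<eta>(5\<tau>)\<close> brings these into the stated form. The zeros of \<open>\<theta>\<^sub>1\<close>, its derivative at
  \<open>0\<close> and its values at the fifths of \<open>\<pi>\<close> are read off the Jacobi triple product, which is the limit of
  a finite identity with Gaussian binomial coefficients.
\<close>

section \<open>The Jacobi triple product\<close>

text \<open>The kernel is found by counting multipliers under \<open>z + pi * \<tau>\<close>: with
  \<open>x = exp (- 2 * \<i> * z)\<close>, \<open>f\<close> contributes \<open>x ^ 8\<close> and
  \<open>theta1 z \<tau>\<close> one more \<open>x\<close>, against \<open>x ^ 4\<close> from
  \<open>theta1 (2 * z) \<tau>\<close> and \<open>x ^ 5\<close> from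
  \<open>theta1 (5 * z) (5 * \<tau>)\<close>. The numerator \<open>theta1 z \<tau>\<close> also
  cancels one of the two zeros of the denominator at lattice points, so that no double pole, and no
  derivative of \<open>f\<close>, appears. The vanishing of the residue sum comes from Liouville's
  theorem instead of a contour integral: no parallelogram has to be placed so that its boundary
  avoids the poles, and a residue is just the limit of \<open>(z - p) * g z\<close>. The price is
  precise knowledge of \<open>theta1\<close>: all its zeros, its multipliers and the simplicity of
  its zero at 0. In the triple product the factor \<open>sin z\<close> is kept in front; this makes
  that zero visible and keeps the series one-sided, in the form that defines
  \<open>theta1\<close>.\<close>

text \<open>This is the q-Pochhammer symbol \<open>(q * u; q)_\<infinity>\<close>. It starts with
  \<open>1 - q * u\<close> and not with \<open>1 - u\<close>: at
  \<open>u = exp (2 * \<i> * z)\<close> the absent factor is the one carried by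
  \<open>sin z\<close>, and \<open>u = 1\<close> gives Euler's product.\<close>

definition qpoch :: "complex \<Rightarrow> complex \<Rightarrow> complex" where
  "qpoch q u = (\<Prod>k. 1 - q ^ Suc k * u)"

lemma summable_norm_power_Suc_mult:
  fixes q u :: complex
  assumes "norm q < 1"
  shows "summable (\<lambda>k. norm (q ^ Suc k * u))"
  unfolding norm_mult norm_power using assms
  by (intro summable_mult2 summable_ignore_initial_segment[of _ 1, simplified] summable_geometric) auto

lemma convergent_prod_qpoch:
  fixes q u :: complex
  assumes "norm q < 1"
  shows "convergent_prod (\<lambda>k. 1 - q ^ Suc k * u)"
proof -
  have "abs_convergent_prod (\<lambda>k. 1 - q ^ Suc k * u)"
    using summable_norm_power_Suc_mult[OF assms, of u]
    by (simp add: abs_convergent_prod_conv_summable norm_minus_commute)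
  then show ?thesis
    by (rule abs_convergent_prod_imp_convergent_prod)
qed

lemma qpoch_LIMSEQ:
  assumes "norm q < 1"
  shows "(\<lambda>N. \<Prod>k<N. 1 - q ^ Suc k * u) \<longlonglongrightarrow> qpoch q u"
  using convergent_prod_LIMSEQ[OF convergent_prod_qpoch[OF assms, of u]]
  unfolding qpoch_def by (simp add: LIMSEQ_lessThan_iff_atMost)

lemma qpoch_nonzero:
  assumes "norm q < 1" "\<And>k. q ^ Suc k * u \<noteq> 1"
  shows "qpoch q u \<noteq> 0"
  unfolding qpoch_def
  by (rule prodinf_nonzero[OF convergent_prod_qpoch[OF assms(1)]]) (use assms(2) in \<open>metis right_minus_eq\<close>)

lemma power_Suc_neq_1:
  fixes q :: complex
  assumes "norm q < 1"
  shows "q ^ Suc k \<noteq> 1"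
  by (metis assms norm_one norm_power norm_ge_zero power_Suc_less_one less_irrefl power_Suc_0
      power_0_Suc zero_neq_one order_le_less)

lemma qpoch_1_nonzero: "norm q < 1 \<Longrightarrow> qpoch q 1 \<noteq> 0"
  by (rule qpoch_nonzero) (auto simp: power_Suc_neq_1 simp del: power_Suc)

text \<open>Splitting off the first factor; this is the functional equation behind the multiplier of
  \<open>theta1\<close> under \<open>z + pi * \<tau>\<close>.\<close>

lemma qpoch_shift:
  assumes "norm q < 1"
  shows "qpoch q u = (1 - q * u) * qpoch q (q * u)"
proof (rule LIMSEQ_unique)
  show "(\<lambda>N. \<Prod>k<Suc N. 1 - q ^ Suc k * u) \<longlonglongrightarrow> qpoch q u"
    by (rule LIMSEQ_Suc[OF qpoch_LIMSEQ[OF assms]])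
  have "(\<Prod>k<Suc N. 1 - q ^ Suc k * u) = (1 - q * u) * (\<Prod>k<N. 1 - q ^ Suc k * (q * u))" for N
    unfolding prod.lessThan_Suc_shift by (simp add: mult_ac)
  then show "(\<lambda>N. \<Prod>k<Suc N. 1 - q ^ Suc k * u) \<longlonglongrightarrow> (1 - q * u) * qpoch q (q * u)"
    by (simp only:) (intro tendsto_intros qpoch_LIMSEQ assms)
qed

text \<open>The convergence is locally uniform: on \<open>cball x 1\<close> the factor with index
  \<open>k\<close> differs from 1 by at most \<open>norm q ^ Suc k * (norm x + 1)\<close>, which is
  summable.\<close>

lemma holomorphic_qpoch:
  assumes "norm q < 1"
  shows "qpoch q holomorphic_on UNIV"
proof (rule holomorphic_uniform_sequence[OF open_UNIV])
  show "(\<lambda>u. \<Prod>k<N. 1 - q ^ Suc k * u) holomorphic_on UNIV" for N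
    by (intro holomorphic_intros)
  fix x :: complex
  have "uniformly_convergent_on (cball x 1) (\<lambda>N u. \<Sum>k<N. norm (- (q ^ Suc k * u)))"
  proof (rule Weierstrass_m_test'_ev)
    show "\<forall>\<^sub>F k in sequentially. \<forall>u\<in>cball x 1. norm (norm (- (q ^ Suc k * u))) \<le> norm (q ^ Suc k * of_real (norm x + 1))"
    proof (intro always_eventually allI ballI)
      fix k u assume "u \<in> cball x 1"
      then have "norm u \<le> norm x + 1"
        by (simp add: dist_norm) (metis norm_triangle_sub add.commute add_left_mono dist_norm norm_minus_commute order_trans)
      then show "norm (norm (- (q ^ Suc k * u))) \<le> norm (q ^ Suc k * of_real (norm x + 1))"
        unfolding norm_minus_cancel norm_mult norm_of_real real_norm_def abs_mult abs_norm_cancel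
        by (intro mult_left_mono) auto
    qed
  qed (rule summable_norm_power_Suc_mult[OF assms])
  then have "uniformly_convergent_on (cball x 1) (\<lambda>N u. \<Prod>k<N. 1 + - (q ^ Suc k * u))"
    by (intro Infinite_Products.uniformly_convergent_on_prod) (auto intro!: continuous_intros)
  then obtain l where l: "uniform_limit (cball x 1) (\<lambda>N u. \<Prod>k<N. 1 - q ^ Suc k * u) l sequentially"
    by (auto simp: uniformly_convergent_on_def)
  have "l u = qpoch q u" if "u \<in> cball x 1" for u
    using tendsto_uniform_limitI[OF l that] qpoch_LIMSEQ[OF assms] LIMSEQ_unique by blast
  then have "uniform_limit (cball x 1) (\<lambda>N u. \<Prod>k<N. 1 - q ^ Suc k * u) (qpoch q) sequentially"
    using l by (metis (no_types, lifting) uniform_limit_cong')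
  then show "\<exists>d>0. cball x d \<subseteq> UNIV \<and> uniform_limit (cball x d) (\<lambda>N u. \<Prod>k<N. 1 - q ^ Suc k * u) (qpoch q) sequentially"
    by (intro exI[of _ 1]) auto
qed

section \<open>Gaussian binomial coefficients and the finite triple product\<close>

definition qfact :: "complex \<Rightarrow> nat \<Rightarrow> complex" where
  "qfact q n = (\<Prod>k<n. 1 - q ^ Suc k)"

lemma qfact_0 [simp]: "qfact q 0 = 1"
  by (simp add: qfact_def)

lemma qfact_Suc: "qfact q (Suc n) = qfact q n * (1 - q ^ Suc n)"
  by (simp add: qfact_def)

lemma qfact_nonzero: "norm q < 1 \<Longrightarrow> qfact q n \<noteq> 0"
  unfolding qfact_def by (auto simp: power_Suc_neq_1 simp del: power_Suc dest: sym)

text \<open>The Gaussian binomial coefficient of \<open>2N + 1\<close> over \<open>N - n\<close>.\<close>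
definition tp_coeff :: "complex \<Rightarrow> nat \<Rightarrow> nat \<Rightarrow> complex" where
  "tp_coeff q N n = (if n \<le> N then qfact q (2 * N + 1) / (qfact q (N - n) * qfact q (N + n + 1)) else 0)"

text \<open>Boundary case of the next recurrence. The coefficient that would have index -1 belongs
  to \<open>sin (- z) = - sin z\<close> and is folded back onto index 0; hence
  \<open>q ^ Suc N\<close> multiplies \<open>tp_coeff q N 0\<close> itself.\<close>

lemma tp_coeff_rec_0:
  assumes "norm q < 1"
  shows "tp_coeff q (Suc N) 0 = (1 + q ^ (2 * N + 2) + q ^ Suc N) * tp_coeff q N 0 + q ^ (N + 2) * tp_coeff q N 1"
proof -
  \<comment> \<open>Over this common denominator all three coefficients are \<open>U\<close> times a
    polynomial in \<open>q\<close> and \<open>q ^ N\<close>, and the recurrence becomes a polynomial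
    identity. The factor \<open>1 - q ^ N\<close> in \<open>e2\<close> vanishes exactly when index 1
    is out of range.\<close>
  define U where "U = qfact q (2 * N + 1) / (qfact q (N + 1) * qfact q (N + 2))"
  note nz = qfact_nonzero[OF assms] power_Suc_neq_1[OF assms, unfolded power_Suc]
  have e1: "tp_coeff q N 0 = U * ((1 - q ^ (N + 1)) * (1 - q ^ (N + 2)))"
    using nz(1)[of N] nz(1)[of "N+1"] nz(2)[of N] nz(2)[of "Suc N"]
    by (simp add: tp_coeff_def U_def qfact_Suc numeral_eq_Suc)
  have e2: "tp_coeff q N 1 = U * ((1 - q ^ (N + 1)) * (1 - q ^ N))"
    using nz(1)[of "N-1"] nz(1)[of "N+1"] nz(2)[of N] nz(2)[of "Suc N"] nz(2)[of "N-1"]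
    by (cases N) (simp_all add: tp_coeff_def U_def qfact_Suc numeral_eq_Suc mult.assoc)
  have e3: "tp_coeff q (Suc N) 0 = U * ((1 - q ^ (2 * N + 2)) * (1 - q ^ (2 * N + 3)))"
    by (simp add: tp_coeff_def U_def qfact_Suc numeral_eq_Suc)
  define b where "b = q ^ N"
  have p: "q ^ (2 * N + 2) = q\<^sup>2 * b\<^sup>2" "q ^ (2 * N + 3) = q ^ 3 * b\<^sup>2"
      "q ^ (N + 1) = q * b" "q ^ (N + 2) = q\<^sup>2 * b" "q ^ Suc N = q * b"
    by (simp_all add: b_def power_add power_mult mult_ac power2_eq_square power3_eq_cube)
  show ?thesis
    unfolding e1 e2 e3 p b_def[symmetric] by algebra
qed

text \<open>The factor \<open>(-1) ^ n * q ^ triangle n\<close> shared by three consecutive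
  coefficients is taken out; \<open>q ^ Suc n\<close> and \<open>q ^ (2 * n + 3)\<close> are what
  remains, by the differences of triangular numbers. Nothing is divided by \<open>q\<close>, so
  \<open>q = 0\<close> is covered.\<close>

lemma tp_coeff_rec_Suc:
  assumes "norm q < 1" "n \<le> N"
  shows "q ^ Suc n * tp_coeff q (Suc N) (Suc n) =
    (1 + q ^ (2 * N + 2)) * (q ^ Suc n * tp_coeff q N (Suc n))
    + q ^ Suc N * (tp_coeff q N n + q ^ (2 * n + 3) * tp_coeff q N (n + 2))"
proof -
  obtain k where N: "N = n + k"
    using assms(2) nat_le_iff_add by blast
  define U where "U = qfact q (2 * N + 1) / (qfact q k * qfact q (N + n + 3))"
  \<comment> \<open>\<open>V\<close> stands for \<open>q ^ (k - 1)\<close>. At \<open>k = 0\<close>,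
    where truncated subtraction would give 1, the term of index \<open>n + 2\<close> is out of range
    and is killed by the factor \<open>1 - q ^ k\<close> in \<open>e3\<close>.\<close>
  define V where "V = (if k = 0 then 0 else q ^ (k - 1))"
  have V: "V * q = (if k = 0 then 0 else q ^ k)"
    by (cases k) (auto simp: V_def)
  note nz = qfact_nonzero[OF assms(1)] power_Suc_neq_1[OF assms(1), unfolded power_Suc]
  have e1: "tp_coeff q N n = U * ((1 - q ^ (N + n + 2)) * (1 - q ^ (N + n + 3)))"
    using nz(1)[of k] nz(1)[of "N+n+1"] nz(2)[of "N+n+1"] nz(2)[of "N+n+2"]
    by (simp add: tp_coeff_def U_def qfact_Suc numeral_eq_Suc N)
  have e2: "tp_coeff q N (Suc n) = U * ((1 - q ^ k) * (1 - q ^ (N + n + 3)))"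
    using nz(1)[of "k-1"] nz(1)[of "N+n+2"] nz(2)[of "N+n+2"] nz(2)[of "k-1"]
    by (cases k) (simp_all add: tp_coeff_def U_def qfact_Suc numeral_eq_Suc N mult.assoc)
  have e3: "tp_coeff q N (n + 2) = U * ((1 - q ^ k) * (1 - V))"
  proof (cases k)
    case (Suc k')
    then show ?thesis
    using nz(1)[of "k'-1"] nz(1)[of "N+n+3"] nz(2)[of "k'-1"] nz(2)[of "k'"]
    by (cases k') (simp_all add: tp_coeff_def U_def qfact_Suc numeral_eq_Suc N V_def mult.assoc)
  qed (simp add: tp_coeff_def N)
  have e4: "tp_coeff q (Suc N) (Suc n) = U * ((1 - q ^ (2 * N + 2)) * (1 - q ^ (2 * N + 3)))"
    by (simp add: tp_coeff_def U_def qfact_Suc numeral_eq_Suc N)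
  define x y where "x = q ^ n" and "y = q ^ k"
  have p: "q ^ (2 * N + 2) = (q * x * y)\<^sup>2" "q ^ (2 * N + 3) = q * (q * x * y)\<^sup>2"
     "q ^ (N + n + 2) = q\<^sup>2 * x\<^sup>2 * y" "q ^ (N + n + 3) = q ^ 3 * x\<^sup>2 * y"
     "q ^ (2 * n + 3) = q ^ 3 * x\<^sup>2" "q ^ Suc N = q * x * y" "q ^ Suc n = q * x"
    unfolding N by (simp_all add: x_def y_def power_add power_mult distrib_left mult_ac power2_eq_square power3_eq_cube)
  \<comment> \<open>Multiplied by \<open>1 - y\<close>, the relation \<open>q * V = y\<close> also
    holds at \<open>k = 0\<close>, where \<open>y = 1\<close>.\<close>
  have "(1 - y) * (q * V) = (1 - y) * y"
    using V by (cases "k = 0") (auto simp: y_def mult.commute)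
  then have "(1 - y) * (q * (q * x)\<^sup>2 * (1 - V)) = (1 - y) * (q * x)\<^sup>2 * (q - y)"
    by algebra
  then have e3': "q ^ 3 * x\<^sup>2 * (U * ((1 - y) * (1 - V))) = U * ((1 - y) * (q * x)\<^sup>2 * (q - y))"
    by algebra
  show ?thesis
    unfolding e1 e2 e3 e4 p y_def[symmetric] e3' by algebra
qed

text \<open>The factor with index \<open>N + 1\<close> is \<open>1 + Q\<^sup>2 - 2 Q cos (2 z)\<close> with \<open>Q = q^(N+1)\<close>, and multiplication by
  \<open>2 cos (2 z)\<close> sends \<open>sin ((2 n + 1) z)\<close> to the sum of its two neighbours; the coefficients on the
  right therefore only have to satisfy the two recurrences above.\<close>
lemma finite_triple_product:
  fixes z :: complex
  assumes "norm q < 1"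
  shows "sin z * (\<Prod>k<N. (1 - q ^ Suc k * exp (2 * \<i> * z)) * (1 - q ^ Suc k * exp (- 2 * \<i> * z))) =
    (\<Sum>n\<le>N. (-1) ^ n * q ^ triangle n * tp_coeff q N n * sin (of_nat (2 * n + 1) * z))"
proof (induction N)
  case 0
  have "tp_coeff q 0 0 = 1"
    using qfact_nonzero[OF assms, of 1] by (simp add: tp_coeff_def)
  then show ?case by simp
next
  case (Suc N)
  define s where "s n = sin (of_nat (2 * n + 1) * z)" for n
  define a where "a N n = (-1) ^ n * q ^ triangle n * tp_coeff q N n" for N n
  define Q where "Q = q ^ Suc N"
  \<comment> \<open>The lower neighbour of \<open>s 0\<close> is \<open>sin (- z) = - s 0\<close>.
    This is the source of the term \<open>- b 0 * s 0\<close> in \<open>sum_s\<close> and of the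
    separate recurrence at index 0.\<close>
  have s0: "2 * cos (2 * z) * s 0 = s 1 - s 0"
  proof -
    have "s 1 = sin (z + 2 * z)" by (simp add: s_def algebra_simps)
    also have "\<dots> = s 0 * cos (2 * z) + 2 * s 0 * (cos z)\<^sup>2"
      unfolding sin_add by (simp add: s_def sin_double power2_eq_square)
    finally have "s 1 = s 0 * cos (2 * z) + 2 * s 0 * (cos z)\<^sup>2" .
    moreover have "cos (2 * z) = 2 * (cos z)\<^sup>2 - 1"
      by (rule cos_double_cos)
    ultimately show ?thesis by algebra
  qed
  have s1: "2 * cos (2 * z) * s (Suc n) = s (n + 2) + s n" for n
  proof -
    have "s (n + 2) = sin (of_nat (2 * Suc n + 1) * z + 2 * z)"
         "s n = sin (of_nat (2 * Suc n + 1) * z - 2 * z)"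
      by (simp_all add: s_def algebra_simps)
    then show ?thesis
      unfolding s_def[of "Suc n"] by (simp add: sin_add sin_diff)
  qed
  have sum_s: "(\<Sum>n\<le>M. b n * (2 * cos (2 * z) * s n)) =
      - b 0 * s 0 + (\<Sum>n\<le>M. b n * s (Suc n)) + (\<Sum>n<M. b (Suc n) * s n)" for b M
  proof (induction M)
    case 0 show ?case by (simp add: s0 right_diff_distrib)
  next
    case (Suc M) then show ?case unfolding sum.atMost_Suc s1 by (simp add: distrib_left)
  qed
  have a_big: "a N (Suc N) = 0" "a N (N + 2) = 0"
    by (auto simp: a_def tp_coeff_def)
  have "(1 - Q * exp (2 * \<i> * z)) * (1 - Q * exp (- 2 * \<i> * z)) = 1 + Q\<^sup>2 - Q * (2 * cos (2 * z))"
  proof -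
    have "exp (2 * \<i> * z) * exp (- 2 * \<i> * z) = 1"
      by (simp flip: exp_add)
    moreover have "2 * cos (2 * z) = exp (2 * \<i> * z) + exp (- 2 * \<i> * z)"
      by (simp add: cos_exp_eq mult_ac)
    ultimately show ?thesis by algebra
  qed
  then have "sin z * (\<Prod>k<Suc N. (1 - q ^ Suc k * exp (2 * \<i> * z)) * (1 - q ^ Suc k * exp (- 2 * \<i> * z))) =
      (\<Sum>n\<le>N. a N n * s n) * (1 + Q\<^sup>2 - Q * (2 * cos (2 * z)))"
    using Suc.IH unfolding a_def s_def prod.lessThan_Suc Q_def by (simp add: mult.assoc)
  also have "\<dots> = (\<Sum>n\<le>N. (1 + Q\<^sup>2) * a N n * s n) - Q * (\<Sum>n\<le>N. a N n * (2 * cos (2 * z) * s n))"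
    by (simp add: algebra_simps sum_distrib_left sum_distrib_right sum_subtractf sum.distrib)
  also have "(\<Sum>n\<le>N. (1 + Q\<^sup>2) * a N n * s n) = (\<Sum>n\<le>Suc N. (1 + Q\<^sup>2) * a N n * s n)"
    by (simp add: a_big)
  also have "\<dots> = (1 + Q\<^sup>2) * a N 0 * s 0 + (\<Sum>n\<le>N. (1 + Q\<^sup>2) * a N (Suc n) * s (Suc n))"
    by (rule sum.atMost_Suc_shift)
  also have "(\<Sum>n\<le>N. a N n * (2 * cos (2 * z) * s n)) =
      - a N 0 * s 0 + (\<Sum>n\<le>N. a N n * s (Suc n)) + (a N 1 * s 0 + (\<Sum>n\<le>N. a N (n + 2) * s (Suc n)))"
  proof -
    have "(\<Sum>n<N. a N (Suc n) * s n) = (\<Sum>n\<le>Suc N. a N (Suc n) * s n)"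
      using a_big by (simp flip: lessThan_Suc_atMost)
    also have "\<dots> = a N 1 * s 0 + (\<Sum>n\<le>N. a N (n + 2) * s (Suc n))"
      by (subst sum.atMost_Suc_shift) simp
    finally show ?thesis
      unfolding sum_s by simp
  qed
  also have "(1 + Q\<^sup>2) * a N 0 * s 0 + (\<Sum>n\<le>N. (1 + Q\<^sup>2) * a N (Suc n) * s (Suc n)) -
      Q * (- a N 0 * s 0 + (\<Sum>n\<le>N. a N n * s (Suc n)) + (a N 1 * s 0 + (\<Sum>n\<le>N. a N (n + 2) * s (Suc n)))) =
      ((1 + Q\<^sup>2 + Q) * a N 0 - Q * a N 1) * s 0 +
      (\<Sum>n\<le>N. ((1 + Q\<^sup>2) * a N (Suc n) - Q * (a N n + a N (n + 2))) * s (Suc n))"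
    by (simp add: algebra_simps sum_distrib_left sum_subtractf sum.distrib)
  also have "(1 + Q\<^sup>2 + Q) * a N 0 - Q * a N 1 = a (Suc N) 0"
    using tp_coeff_rec_0[OF assms, of N]
    by (simp add: a_def Q_def power_mult power_add algebra_simps power2_eq_square flip: power_mult_distrib)
  also have "(\<Sum>n\<le>N. ((1 + Q\<^sup>2) * a N (Suc n) - Q * (a N n + a N (n + 2))) * s (Suc n)) =
      (\<Sum>n\<le>N. a (Suc N) (Suc n) * s (Suc n))"
  proof (intro sum.cong refl, goal_cases)
    case (1 n)
    define c where "c = (-1) ^ n * q ^ triangle n"
    have a: "a M n = c * tp_coeff q M n" "a M (Suc n) = - c * (q ^ Suc n * tp_coeff q M (Suc n))"
      "a M (n + 2) = c * (q ^ (2 * n + 3) * tp_coeff q M (n + 2))" for M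
      by (simp_all add: a_def c_def power_add mult_ac numeral_eq_Suc)
    have "q ^ (2 * N + 2) = Q\<^sup>2"
      by (simp add: Q_def power_mult power_mult_distrib power2_eq_square mult_ac)
    then have "(1 + Q\<^sup>2) * a N (Suc n) - Q * (a N n + a N (n + 2)) = a (Suc N) (Suc n)"
      using tp_coeff_rec_Suc[OF assms, of n N] 1
      unfolding a Q_def[symmetric] by (simp only: distrib_left right_diff_distrib atMost_iff) (simp add: algebra_simps)
    then show ?case by simp
  qed
  also have "a (Suc N) 0 * s 0 + (\<Sum>n\<le>N. a (Suc N) (Suc n) * s (Suc n)) = (\<Sum>n\<le>Suc N. a (Suc N) n * s n)"
    by (rule sum.atMost_Suc_shift[symmetric])
  finally show ?case
    unfolding a_def s_def .
qed

section \<open>Passage to the limit in the finite identity\<close>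

lemma qfact_LIMSEQ: "norm q < 1 \<Longrightarrow> qfact q \<longlonglongrightarrow> qpoch q 1"
  using qpoch_LIMSEQ[of q 1] unfolding qfact_def by simp

lemma tp_coeff_LIMSEQ:
  assumes "norm q < 1"
  shows "(\<lambda>N. tp_coeff q N n) \<longlonglongrightarrow> 1 / qpoch q 1"
proof -
  have f: "filterlim (\<lambda>N. 2 * N + 1) sequentially sequentially"
    "filterlim (\<lambda>N. N - n) sequentially sequentially"
    "filterlim (\<lambda>N. N + n + 1) sequentially sequentially"
    by (rule filterlim_subseq, simp add: strict_mono_def, rule filterlim_minus_const_nat_at_top,
        rule filterlim_subseq, simp add: strict_mono_def)
  have "(\<lambda>N. qfact q (2 * N + 1) / (qfact q (N - n) * qfact q (N + n + 1))) \<longlonglongrightarrow> qpoch q 1 / (qpoch q 1 * qpoch q 1)"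
    by (intro tendsto_intros filterlim_compose[OF qfact_LIMSEQ[OF assms] f(1)]
       filterlim_compose[OF qfact_LIMSEQ[OF assms] f(2)] filterlim_compose[OF qfact_LIMSEQ[OF assms] f(3)])
      (use qpoch_1_nonzero[OF assms] in simp)
  moreover have "\<forall>\<^sub>F N in sequentially. qfact q (2 * N + 1) / (qfact q (N - n) * qfact q (N + n + 1)) = tp_coeff q N n"
    using eventually_ge_at_top[of n] by eventually_elim (simp add: tp_coeff_def)
  ultimately show ?thesis
    using qpoch_1_nonzero[OF assms] by (simp add: tendsto_cong)
qed

text \<open>\<open>qfact q\<close> and its inverse both converge, hence are bounded. A bound uniform
  in \<open>N\<close> and \<open>n\<close> provides the majorant for Tannery's theorem.\<close>

lemma tp_coeff_bounded:
  assumes "norm q < 1"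
  obtains C where "C > 0" "\<And>N n. norm (tp_coeff q N n) \<le> C"
proof -
  have "Bseq (qfact q)"
    using qfact_LIMSEQ[OF assms] by (intro convergent_imp_Bseq convergentI)
  then obtain A where A: "A > 0" "\<And>n. norm (qfact q n) \<le> A"
    by (auto simp: Bseq_def)
  have "Bseq (\<lambda>n. inverse (qfact q n))"
    using tendsto_inverse[OF qfact_LIMSEQ[OF assms] qpoch_1_nonzero[OF assms]] by (intro convergent_imp_Bseq convergentI)
  then obtain B where B: "B > 0" "\<And>n. norm (inverse (qfact q n)) \<le> B"
    by (auto simp: Bseq_def)
  have "norm (tp_coeff q N n) \<le> A * (B * B)" for N n
  proof -
    have "norm (qfact q (2 * N + 1) * (inverse (qfact q (N - n)) * inverse (qfact q (N + n + 1)))) \<le> A * (B * B)"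
      unfolding norm_mult using A B by (intro mult_mono) (auto simp: less_imp_le)
    then show ?thesis
      using A B by (auto simp: tp_coeff_def field_simps)
  qed
  then show ?thesis
    using that[of "A * (B * B)"] A B by simp
qed

lemma norm_sin_le_exp: "norm (sin (w::complex)) \<le> exp (norm w)"
proof -
  have "norm (sin w) = norm (exp (\<i> * w) - exp (- (\<i> * w))) / 2"
    by (simp add: sin_exp_eq norm_divide norm_mult)
  also have "\<dots> \<le> (norm (exp (\<i> * w)) + norm (exp (- (\<i> * w)))) / 2"
    by (intro divide_right_mono norm_triangle_ineq4) auto
  also have "\<dots> \<le> (exp (norm w) + exp (norm w)) / 2"
    by (intro divide_right_mono add_mono order_trans[OF norm_exp]) (auto simp: norm_mult)
  finally show ?thesis by simp
qed

text \<open>The ratio of consecutive terms, \<open>q ^ Suc n * r\<close>, tends to 0: the quadratic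
  exponent absorbs the geometric growth of \<open>sin ((2 * n + 1) * z)\<close> for complex
  \<open>z\<close>.\<close>

lemma summable_power_triangle:
  fixes q r :: real
  assumes "0 \<le> q" "q < 1" "0 \<le> r"
  shows "summable (\<lambda>n. q ^ triangle n * r ^ n)"
proof -
  have "(\<lambda>n. q ^ Suc n * r) \<longlonglongrightarrow> 0 * r"
    using assms by (intro tendsto_intros LIMSEQ_Suc LIMSEQ_realpow_zero)
  then have "\<forall>\<^sub>F n in sequentially. q ^ Suc n * r < 1 / 2"
    by (rule order_tendstoD) simp
  then obtain N where N: "\<And>n. n \<ge> N \<Longrightarrow> q ^ Suc n * r < 1 / 2"
    by (auto simp: eventually_sequentially)
  show ?thesis
  proof (rule summable_ratio_test)
    show "(1 / 2 :: real) < 1" by simp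
    fix n assume "n \<ge> N"
    have "norm (q ^ triangle (Suc n) * r ^ Suc n) = (q ^ Suc n * r) * (q ^ triangle n * r ^ n)"
      using assms by (simp add: power_add abs_mult mult_ac)
    also have "\<dots> \<le> 1 / 2 * (q ^ triangle n * r ^ n)"
      using N[OF \<open>n \<ge> N\<close>] assms by (intro mult_right_mono) auto
    finally show "norm (q ^ triangle (Suc n) * r ^ Suc n) \<le> 1 / 2 * norm (q ^ triangle n * r ^ n)"
      using assms by (simp add: abs_mult)
  qed
qed

text \<open>Limit of \<open>finite_triple_product\<close> term by term, justified by Tannery's
  theorem. Every Gaussian coefficient tends to \<open>1 / qpoch q 1\<close>; clearing this
  denominator yields the third product.\<close>

theorem triple_product_sine:
  fixes z :: complex
  assumes q: "norm q < 1"
  shows "(\<lambda>n. (-1) ^ n * q ^ triangle n * sin (of_nat (2 * n + 1) * z)) sums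
    (sin z * qpoch q 1 * qpoch q (exp (2 * \<i> * z)) * qpoch q (exp (- 2 * \<i> * z)))"
proof -
  obtain C where C: "C > 0" "\<And>N n. norm (tp_coeff q N n) \<le> C"
    using tp_coeff_bounded[OF q] by metis
  define r where "r = exp (norm z)"
  define b where "b n = (-1) ^ n * q ^ triangle n * (1 / qpoch q 1) * sin (of_nat (2 * n + 1) * z)" for n
  define a where "a n N = (-1) ^ n * q ^ triangle n * tp_coeff q N n * sin (of_nat (2 * n + 1) * z)" for n N
  define M where "M n = C * r * (norm q ^ triangle n * (r\<^sup>2) ^ n)" for n
  have "norm (a n N) \<le> M n" for n N
  proof -
    have "norm (sin (of_nat (2 * n + 1) * z)) \<le> exp (norm (of_nat (2 * n + 1) * z))"
      by (rule norm_sin_le_exp)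
    also have "\<dots> = r ^ (2 * n + 1)"
      unfolding r_def norm_mult norm_of_nat exp_of_nat_mult ..
    also have "\<dots> = r * (r\<^sup>2) ^ n"
      by (simp add: power_mult)
    finally have "norm (a n N) \<le> norm q ^ triangle n * C * (r * (r\<^sup>2) ^ n)"
      unfolding a_def norm_mult norm_power using C by (intro mult_mono) (auto simp: less_imp_le)
    then show ?thesis by (simp add: M_def mult_ac)
  qed
  then have "\<forall>\<^sub>F (n, N) in at_top \<times>\<^sub>F sequentially. norm (a n N) \<le> M n"
    by (intro always_eventually) auto
  moreover have "summable M"
    unfolding M_def using q by (intro summable_mult summable_power_triangle) (auto simp: r_def)
  moreover have "a n \<longlonglongrightarrow> b n" for n
    unfolding a_def b_def by (intro tendsto_intros tp_coeff_LIMSEQ q)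
  ultimately have T: "summable (\<lambda>n. norm (b n))" "(\<lambda>N. \<Sum>n. a n N) \<longlonglongrightarrow> suminf b"
    using tannerys_theorem[of a b sequentially M] by auto
  have "(\<Sum>n. a n N) = sin z * (\<Prod>k<N. (1 - q ^ Suc k * exp (2 * \<i> * z)) * (1 - q ^ Suc k * exp (- 2 * \<i> * z)))" for N
    unfolding finite_triple_product[OF q]
    by (subst suminf_finite[of "{..N}"]) (auto simp: a_def tp_coeff_def)
  moreover have "(\<lambda>N. sin z * (\<Prod>k<N. (1 - q ^ Suc k * exp (2 * \<i> * z)) * (1 - q ^ Suc k * exp (- 2 * \<i> * z))))
      \<longlonglongrightarrow> sin z * (qpoch q (exp (2 * \<i> * z)) * qpoch q (exp (- 2 * \<i> * z)))"
    unfolding prod.distrib by (intro tendsto_intros qpoch_LIMSEQ q)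
  ultimately have "suminf b = sin z * (qpoch q (exp (2 * \<i> * z)) * qpoch q (exp (- 2 * \<i> * z)))"
    using T(2) LIMSEQ_unique by auto
  then have "b sums (sin z * (qpoch q (exp (2 * \<i> * z)) * qpoch q (exp (- 2 * \<i> * z))))"
    using summable_norm_cancel[OF T(1)] by (simp add: sums_iff)
  from sums_mult[OF this, of "qpoch q 1"] show ?thesis
    using qpoch_1_nonzero[OF q] by (simp add: b_def mult_ac)
qed

section \<open>The function theta1\<close>

lemma qpow_add: "qpow (a + b) \<tau> = qpow a \<tau> * qpow b \<tau>"
  by (simp add: qpow_def ring_distribs flip: exp_add)

lemma qpow_of_nat_mult: "qpow (real n * a) \<tau> = qpow a \<tau> ^ n"
  unfolding qpow_def by (subst exp_of_nat_mult[symmetric]) (simp add: mult_ac)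

lemma qpow_nonzero [simp]: "qpow a \<tau> \<noteq> 0"
  by (simp add: qpow_def)

lemma qpow_scale: "qpow a (of_real c * \<tau>) = qpow (a * c) \<tau>"
  by (simp add: qpow_def mult_ac)

lemma norm_qpow_less_1: "Im \<tau> > 0 \<Longrightarrow> a > 0 \<Longrightarrow> norm (qpow a \<tau>) < 1"
  by (simp add: qpow_def)

lemma qpow_Suc: "qpow (real (Suc n)) \<tau> = qpow 1 \<tau> ^ Suc n"
  using qpow_of_nat_mult[of "Suc n" 1 \<tau>] by simp

lemma dedekind_eta_qpoch: "dedekind_eta \<tau> = qpow (1 / 24) \<tau> * qpoch (qpow 1 \<tau>) 1"
  unfolding dedekind_eta_def qpoch_def qpow_Suc by simp

lemma dedekind_eta_nonzero: "Im \<tau> > 0 \<Longrightarrow> dedekind_eta \<tau> \<noteq> 0"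
  by (simp add: dedekind_eta_qpoch qpoch_1_nonzero norm_qpow_less_1)

lemma qpow_square_eighth: "qpow ((2 * real n + 1)\<^sup>2 / 8) \<tau> = qpow (1 / 8) \<tau> * qpow 1 \<tau> ^ triangle n"
proof -
  have "real (2 * triangle n) = real (n * Suc n)"
    unfolding triangle_def by (subst dvd_mult_div_cancel) auto
  then have "2 * real (triangle n) = real n * (real n + 1)"
    by (simp add: algebra_simps)
  then have "(2 * real n + 1)\<^sup>2 / 8 = 1 / 8 + real (triangle n) * 1"
    by (simp add: power2_eq_square field_simps)
  then show ?thesis
    by (simp only: qpow_add qpow_of_nat_mult)
qed

lemma
  assumes "Im \<tau> > 0"
  shows theta1_sums: "(\<lambda>n. (-1) ^ n * qpow ((2 * real n + 1)\<^sup>2 / 8) \<tau> * sin (of_nat (2 * n + 1) * z)) sums (theta1 z \<tau> / 2)"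
    and theta1_product: "theta1 z \<tau> = 2 * qpow (1 / 8) \<tau> * sin z * qpoch (qpow 1 \<tau>) 1
      * qpoch (qpow 1 \<tau>) (exp (2 * \<i> * z)) * qpoch (qpow 1 \<tau>) (exp (- 2 * \<i> * z))"
proof -
  have q: "norm (qpow 1 \<tau>) < 1"
    using assms by (simp add: norm_qpow_less_1)
  have *: "(\<lambda>n. (-1) ^ n * qpow ((2 * real n + 1)\<^sup>2 / 8) \<tau> * sin (of_nat (2 * n + 1) * z)) sums
     (qpow (1 / 8) \<tau> * (sin z * qpoch (qpow 1 \<tau>) 1
      * qpoch (qpow 1 \<tau>) (exp (2 * \<i> * z)) * qpoch (qpow 1 \<tau>) (exp (- 2 * \<i> * z))))"
    unfolding qpow_square_eighth
    using sums_mult[OF triple_product_sine[OF q, of z], of "qpow (1 / 8) \<tau>"]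
    by (simp add: mult_ac)
  then show "theta1 z \<tau> = 2 * qpow (1 / 8) \<tau> * sin z * qpoch (qpow 1 \<tau>) 1
      * qpoch (qpow 1 \<tau>) (exp (2 * \<i> * z)) * qpoch (qpow 1 \<tau>) (exp (- 2 * \<i> * z))"
    unfolding theta1_def sums_iff by (simp add: mult_ac)
  from sums_summable[OF *] show "(\<lambda>n. (-1) ^ n * qpow ((2 * real n + 1)\<^sup>2 / 8) \<tau> * sin (of_nat (2 * n + 1) * z)) sums (theta1 z \<tau> / 2)"
    unfolding theta1_def by (simp add: summable_sums)
qed

lemma theta1_0 [simp]: "theta1 0 \<tau> = 0"
  by (simp add: theta1_def)

lemma theta1_minus: "Im \<tau> > 0 \<Longrightarrow> theta1 (- z) \<tau> = - theta1 z \<tau>"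
  by (simp add: theta1_product mult_ac)

lemma theta1_plus_pi:
  assumes "Im \<tau> > 0"
  shows "theta1 (z + of_real pi) \<tau> = - theta1 z \<tau>"
proof -
  have "exp (2 * \<i> * (z + of_real pi)) = exp (2 * \<i> * z)" "exp (- 2 * \<i> * (z + of_real pi)) = exp (- 2 * \<i> * z)"
    by (rule exp_eq[THEN iffD2], rule exI[of _ 1], simp add: algebra_simps,
        rule exp_eq[THEN iffD2], rule exI[of _ "-1"], simp add: algebra_simps)
  moreover have "sin (z + of_real pi) = - sin z"
    by (simp add: sin_add)
  ultimately show ?thesis
    using assms by (simp only: theta1_product) simp
qed

text \<open>Under the shift \<open>exp (2 * \<i> * z)\<close> is multiplied by \<open>q\<close> and
  its inverse is divided by \<open>q\<close>, so one product loses its first factor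
  (\<open>p1\<close>) and the other gains a new one (\<open>p2\<close>). Together with the change of
  the sine they leave an elementary multiplier, computed in \<open>k\<close>.\<close>

lemma theta1_plus_pi_tau:
  assumes "Im \<tau> > 0"
  shows "theta1 (z + of_real pi * \<tau>) \<tau> = - qpow (- 1 / 2) \<tau> * exp (- 2 * \<i> * z) * theta1 z \<tau>"
proof -
  define q where "q = qpow 1 \<tau>"
  define e where "e = exp (\<i> * z)"
  define h where "h = qpow (1 / 2) \<tau>"
  have nz: "e \<noteq> 0" "h \<noteq> 0" by (simp_all add: e_def h_def)
  have q: "norm q < 1"
    using assms by (simp add: q_def norm_qpow_less_1)
  have qh: "q = h\<^sup>2"
    using qpow_of_nat_mult[of 2 "1/2" \<tau>] by (simp add: q_def h_def)
  have h': "qpow (- 1 / 2) \<tau> = 1 / h"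
    using qpow_add[of "1/2" "-1/2" \<tau>] nz by (simp add: h_def[symmetric] field_simps) (simp add: qpow_def)
  have ex: "exp (2 * \<i> * w) = (exp (\<i> * w))\<^sup>2" "exp (- 2 * \<i> * w) = 1 / (exp (\<i> * w))\<^sup>2" for w
    by (simp_all add: mult.assoc exp_double[symmetric] exp_minus inverse_eq_divide)
  have e: "exp (2 * \<i> * z) = e\<^sup>2" "exp (- 2 * \<i> * z) = 1 / e\<^sup>2"
    unfolding ex e_def by simp_all
  have eh: "exp (\<i> * (z + of_real pi * \<tau>)) = e * h"
    by (simp add: e_def h_def qpow_def algebra_simps flip: exp_add)
  have "sin w = (exp (\<i> * w) - 1 / exp (\<i> * w)) / (2 * \<i>)" for w
    by (simp add: sin_exp_eq exp_minus inverse_eq_divide)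
  then have s: "sin z = (e - 1 / e) / (2 * \<i>)" "sin (z + of_real pi * \<tau>) = (e * h - 1 / (e * h)) / (2 * \<i>)"
    by (simp_all only: eh e_def)
  have e2: "exp (2 * \<i> * (z + of_real pi * \<tau>)) = (e * h)\<^sup>2" "exp (- 2 * \<i> * (z + of_real pi * \<tau>)) = 1 / (e * h)\<^sup>2"
    unfolding ex eh by simp_all
  have p1: "qpoch q (e\<^sup>2) = (1 - (e * h)\<^sup>2) * qpoch q ((e * h)\<^sup>2)"
    using qpoch_shift[OF q, of "e\<^sup>2"] by (simp add: qh power_mult_distrib mult_ac)
  have p2: "qpoch q (1 / (e * h)\<^sup>2) = (1 - 1 / e\<^sup>2) * qpoch q (1 / e\<^sup>2)"
    using qpoch_shift[OF q, of "1 / (e * h)\<^sup>2"] nz by (simp add: qh power_mult_distrib mult_ac)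
  have k: "(e * h - 1 / (e * h)) * (1 - 1 / e\<^sup>2) = - (1 / h) * (1 / e\<^sup>2) * (e - 1 / e) * (1 - (e * h)\<^sup>2)"
    using nz by (simp add: field_simps power2_eq_square)
  have "(e * h - 1 / (e * h)) / (2 * \<i>) * qpoch q ((e * h)\<^sup>2) * qpoch q (1 / (e * h)\<^sup>2) =
      ((e * h - 1 / (e * h)) * (1 - 1 / e\<^sup>2)) / (2 * \<i>) * qpoch q ((e * h)\<^sup>2) * qpoch q (1 / e\<^sup>2)"
    unfolding p2 by simp
  also have "\<dots> = - (1 / h) * (1 / e\<^sup>2) * ((e - 1 / e) / (2 * \<i>) * qpoch q (e\<^sup>2) * qpoch q (1 / e\<^sup>2))"
    unfolding k p1 by simp
  finally have k2: "(e * h - 1 / (e * h)) / (2 * \<i>) * qpoch q ((e * h)\<^sup>2) * qpoch q (1 / (e * h)\<^sup>2) =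
      - (1 / h) * (1 / e\<^sup>2) * ((e - 1 / e) / (2 * \<i>) * qpoch q (e\<^sup>2) * qpoch q (1 / e\<^sup>2))" .
  have "theta1 (z + of_real pi * \<tau>) \<tau> = 2 * qpow (1 / 8) \<tau> * qpoch q 1 *
      ((e * h - 1 / (e * h)) / (2 * \<i>) * qpoch q ((e * h)\<^sup>2) * qpoch q (1 / (e * h)\<^sup>2))"
    unfolding theta1_product[OF assms] q_def[symmetric] e2 s by (simp only: mult_ac)
  also have "\<dots> = - (1 / h) * (1 / e\<^sup>2) *
      (2 * qpow (1 / 8) \<tau> * ((e - 1 / e) / (2 * \<i>)) * qpoch q 1 * qpoch q (e\<^sup>2) * qpoch q (1 / e\<^sup>2))"
    unfolding k2 by (simp only: mult_ac)
  finally show ?thesis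
    unfolding theta1_product[OF assms, of z] q_def[symmetric] h' e s .
qed

lemma holomorphic_theta1:
  assumes "Im \<tau> > 0"
  shows "(\<lambda>z. theta1 z \<tau>) holomorphic_on A"
proof -
  have q: "qpoch (qpow 1 \<tau>) holomorphic_on UNIV"
    using assms by (simp add: norm_qpow_less_1 holomorphic_qpoch)
  have "(\<lambda>z. qpoch (qpow 1 \<tau>) (exp (c * z))) holomorphic_on A" for c
    by (rule holomorphic_on_compose_gen[OF _ q, unfolded o_def]) (auto intro!: holomorphic_intros)
  then show ?thesis
    unfolding theta1_product[OF assms] by (intro holomorphic_intros)
qed

text \<open>With \<open>sin z\<close> split off, the derivative at 0 is the value there of the other
  factor \<open>G\<close>. It contains three copies of Euler's product, and
  \<open>1 / 8 = 3 / 24\<close> turns them into the cube of eta.\<close>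

lemma theta1_has_derivative_0:
  assumes "Im \<tau> > 0"
  shows "((\<lambda>z. theta1 z \<tau>) has_field_derivative 2 * dedekind_eta \<tau> ^ 3) (at 0)"
proof -
  define q where "q = qpow 1 \<tau>"
  define G where "G z = 2 * qpow (1 / 8) \<tau> * qpoch q 1 * qpoch q (exp (2 * \<i> * z)) * qpoch q (exp (- 2 * \<i> * z))" for z
  have q: "qpoch q holomorphic_on UNIV"
    using assms by (simp add: q_def norm_qpow_less_1 holomorphic_qpoch)
  have "(\<lambda>z. qpoch q (exp (c * z))) holomorphic_on UNIV" for c
    by (rule holomorphic_on_compose_gen[OF _ q, unfolded o_def]) (auto intro!: holomorphic_intros)
  then have "G holomorphic_on UNIV"
    unfolding G_def by (intro holomorphic_intros)
  then have "(G has_field_derivative deriv G 0) (at 0)"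
    by (rule holomorphic_derivI) auto
  then have "((\<lambda>z. sin z * G z) has_field_derivative G 0) (at 0)"
    by (auto intro!: derivative_eq_intros)
  moreover have "G 0 = 2 * dedekind_eta \<tau> ^ 3"
    using qpow_of_nat_mult[of 3 "1/24" \<tau>]
    by (simp add: G_def dedekind_eta_qpoch q_def power_mult_distrib power3_eq_cube)
  moreover have "(\<lambda>z. theta1 z \<tau>) = (\<lambda>z. sin z * G z)"
    unfolding theta1_product[OF assms] G_def q_def by (simp add: mult_ac)
  ultimately show ?thesis by simp
qed

section \<open>Zeros of theta1\<close>

text \<open>The codomain of \<open>Q\<close> is left open, so that the lemma serves both for
  periodic functions and for predicates such as vanishing at \<open>z\<close>.\<close>

lemma lattice_invariant:
  assumes "\<And>z. Q (z + of_real pi) = Q z" "\<And>z. Q (z + of_real pi * \<tau>) = Q z"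
  shows "Q (z + (of_int m * of_real pi + of_int n * of_real pi * \<tau>)) = Q z"
proof -
  have m: "Q (w + of_int m * of_real pi) = Q w" for w
  proof (induction m rule: int_induct[of _ 0])
    case (step1 i)
    then show ?case using assms(1)[of "w + of_int i * of_real pi"] by (simp add: algebra_simps)
  next
    case (step2 i)
    then show ?case using assms(1)[of "w + of_int (i - 1) * of_real pi"] by (simp add: algebra_simps)
  qed simp
  have "Q (w + of_int n * of_real pi * \<tau>) = Q w" for w
  proof (induction n rule: int_induct[of _ 0])
    case (step1 i)
    then show ?case using assms(2)[of "w + of_int i * of_real pi * \<tau>"] by (simp add: algebra_simps)
  next
    case (step2 i)
    then show ?case using assms(2)[of "w + of_int (i - 1) * of_real pi * \<tau>"] by (simp add: algebra_simps)
  qed simp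
  from this[of "z + of_int m * of_real pi"] show ?thesis
    using m[of z] by (simp add: add.assoc)
qed

lemma theta1_eq_0_lattice_shift:
  assumes "Im \<tau> > 0"
  shows "theta1 (z + (of_int m * of_real pi + of_int n * of_real pi * \<tau>)) \<tau> = 0 \<longleftrightarrow> theta1 z \<tau> = 0"
  by (rule lattice_invariant[where Q = "\<lambda>z. theta1 z \<tau> = 0"])
     (use assms in \<open>simp_all add: theta1_plus_pi theta1_plus_pi_tau\<close>)

text \<open>A convergent product vanishes only if one of its factors does. The sine yields the zeros
  with \<open>n = 0\<close>, the factors \<open>1 - q ^ Suc k * exp (2 * \<i> * z)\<close> those
  with \<open>n < 0\<close>, and the same argument at \<open>- z\<close> those with
  \<open>n > 0\<close>.\<close>

lemma theta1_eq_0_iff: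
  assumes "Im \<tau> > 0"
  shows "theta1 z \<tau> = 0 \<longleftrightarrow> (\<exists>m n::int. z = of_int m * of_real pi + of_int n * of_real pi * \<tau>)"
proof
  assume "theta1 z \<tau> = 0"
  have q: "norm (qpow 1 \<tau>) < 1"
    using assms by (simp add: norm_qpow_less_1)
  have exp_case: "\<exists>m n::int. w = of_int m * of_real pi + of_int n * of_real pi * \<tau>"
    if w: "qpoch (qpow 1 \<tau>) (exp (2 * \<i> * w)) = 0" for w
  proof -
    obtain k where "qpow 1 \<tau> ^ Suc k * exp (2 * \<i> * w) = 1"
      using qpoch_nonzero[OF q] w by metis
    then have "exp (2 * of_real pi * \<i> * of_nat (Suc k) * \<tau> + 2 * \<i> * w) = exp 0"
      unfolding qpow_Suc[symmetric] by (simp add: qpow_def exp_add)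
    then obtain n :: int where "2 * of_real pi * \<i> * of_nat (Suc k) * \<tau> + 2 * \<i> * w = 0 + complex_of_real (of_int (2 * n) * pi) * \<i>"
      unfolding exp_eq by blast
    then have E: "2 * of_real pi * \<i> * of_nat (Suc k) * \<tau> + 2 * \<i> * w = 2 * of_int n * of_real pi * \<i>"
      by (simp only: of_real_mult of_real_of_int_eq of_int_mult of_int_numeral of_real_numeral add_0_left)
    have "(2 * \<i>) * w = (2 * \<i>) * (of_int n * of_real pi - of_nat (Suc k) * of_real pi * \<tau>)"
      using E by algebra
    then have "w = of_int n * of_real pi - of_nat (Suc k) * of_real pi * \<tau>"
      by (subst (asm) mult_left_cancel) simp_all
    then have "w = of_int n * of_real pi + of_int (- int (Suc k)) * of_real pi * \<tau>"
      by (simp add: algebra_simps)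
    then show ?thesis by blast
  qed
  have "sin z = 0 \<or> qpoch (qpow 1 \<tau>) (exp (2 * \<i> * z)) = 0 \<or> qpoch (qpow 1 \<tau>) (exp (2 * \<i> * (- z))) = 0"
    using \<open>theta1 z \<tau> = 0\<close> qpoch_1_nonzero[OF q] by (auto simp: theta1_product[OF assms])
  then show "\<exists>m n::int. z = of_int m * of_real pi + of_int n * of_real pi * \<tau>"
  proof (elim disjE)
    assume "sin z = 0"
    then obtain m :: int where "z = of_int m * of_real pi"
      by (auto simp: sin_eq_0)
    then show ?thesis by (intro exI[of _ m] exI[of _ 0]) simp
  next
    assume "qpoch (qpow 1 \<tau>) (exp (2 * \<i> * (- z))) = 0"
    then obtain m n :: int where "- z = of_int m * of_real pi + of_int n * of_real pi * \<tau>"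
      using exp_case by blast
    then have "z = of_int (- m) * of_real pi + of_int (- n) * of_real pi * \<tau>"
      by (simp add: algebra_simps minus_equation_iff[of z] add_eq_0_iff)
    then show ?thesis by blast
  qed (rule exp_case)
next
  assume "\<exists>m n::int. z = of_int m * of_real pi + of_int n * of_real pi * \<tau>"
  then show "theta1 z \<tau> = 0"
    using theta1_eq_0_lattice_shift[OF assms, of 0] by auto
qed

section \<open>Values of theta1 at the half periods\<close>

lemma sin_odd_half_pi: "sin (of_nat (2 * n + 1) * (of_real pi / 2)) = ((-1) ^ n :: complex)"
  and cos_odd_half_pi: "cos (of_nat (2 * n + 1) * (of_real pi / 2)) = (0 :: complex)"
proof -
  have e: "of_nat (2 * n + 1) * (of_real pi / 2) = (of_real (pi / 2 + real n * pi) :: complex)"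
    by (simp add: field_simps)
  show "sin (of_nat (2 * n + 1) * (of_real pi / 2)) = ((-1) ^ n :: complex)"
    unfolding e sin_of_real by (simp add: sin_add)
  show "cos (of_nat (2 * n + 1) * (of_real pi / 2)) = (0 :: complex)"
    unfolding e cos_of_real by (simp add: cos_add)
qed

lemma theta1_half_pi: "theta1 (of_real pi / 2) \<tau> = vartheta2 \<tau>"
  unfolding theta1_def vartheta2_def sin_odd_half_pi
  by (simp add: mult_ac flip: power_mult_distrib)

lemma summable_qpow_square:
  fixes \<epsilon> :: complex
  assumes "Im \<tau> > 0" "norm \<epsilon> = 1"
  shows "summable (\<lambda>n. \<epsilon> ^ n * qpow ((real n)\<^sup>2 / 2) \<tau>)"
proof (rule summable_comparison_test)
  have h: "norm (qpow (1 / 2) \<tau>) < 1"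
    using assms by (simp add: norm_qpow_less_1)
  then show "summable (\<lambda>n. norm (qpow (1 / 2) \<tau>) ^ n)"
    by (simp add: summable_geometric)
  have "norm (\<epsilon> ^ n * qpow ((real n)\<^sup>2 / 2) \<tau>) \<le> norm (qpow (1 / 2) \<tau>) ^ n" for n
  proof -
    have "qpow ((real n)\<^sup>2 / 2) \<tau> = qpow (1 / 2) \<tau> ^ (n\<^sup>2)"
      using qpow_of_nat_mult[of "n\<^sup>2" "1/2" \<tau>] by simp
    moreover have "norm (qpow (1 / 2) \<tau>) ^ (n\<^sup>2) \<le> norm (qpow (1 / 2) \<tau>) ^ n"
      using h by (intro power_decreasing) (auto simp: power2_eq_square)
    ultimately show ?thesis
      using assms(2) by (simp add: norm_mult norm_power)
  qed
  then show "\<exists>N. \<forall>n\<ge>N. norm (\<epsilon> ^ n * qpow ((real n)\<^sup>2 / 2) \<tau>) \<le> norm (qpow (1 / 2) \<tau>) ^ n"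
    by blast
qed

text \<open>At the half periods involving \<open>\<tau>\<close> each sine splits into two
  exponentials with exponents \<open>(n + 1)^2 / 2\<close> and \<open>n^2 / 2\<close> up to a
  constant. Every square except 0 thus occurs twice, which is the shape \<open>1 + 2 * ...\<close>
  of \<open>vartheta3\<close> (\<open>\<epsilon> = 1\<close>) and \<open>vartheta4\<close>
  (\<open>\<epsilon> = - 1\<close>).\<close>

lemma sums_adjacent_square_terms:
  fixes \<epsilon> :: complex
  assumes "Im \<tau> > 0" "norm \<epsilon> = 1"
  shows "(\<lambda>n. \<epsilon> ^ Suc n * qpow ((real (Suc n))\<^sup>2 / 2) \<tau> + \<epsilon> ^ n * qpow ((real n)\<^sup>2 / 2) \<tau>) sums
    (1 + 2 * (\<Sum>n. \<epsilon> ^ Suc n * qpow ((real (Suc n))\<^sup>2 / 2) \<tau>))"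
proof -
  define v where "v n = \<epsilon> ^ n * qpow ((real n)\<^sup>2 / 2) \<tau>" for n
  have "summable v"
    unfolding v_def by (rule summable_qpow_square[OF assms])
  moreover from this have "summable (\<lambda>n. v (Suc n))"
    by (simp add: summable_Suc_iff)
  ultimately have "(\<lambda>n. v (Suc n) + v n) sums (suminf (\<lambda>n. v (Suc n)) + suminf v)"
    by (intro sums_add summable_sums)
  moreover have "suminf v = 1 + suminf (\<lambda>n. v (Suc n))"
    using suminf_split_head[OF \<open>summable v\<close>] by (simp add: v_def qpow_def)
  ultimately show ?thesis
    by (simp add: v_def algebra_simps)
qed

text \<open>Completing the square in \<open>(2 * n + 1)^2 / 8\<close> plus or minus
  \<open>(2 * n + 1) / 4\<close>; the constant left over is \<open>- 1 / 8\<close>.\<close>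

lemma qpow_half_period_exponents:
  "qpow ((2 * real n + 1)\<^sup>2 / 8) \<tau> * qpow ((2 * real n + 1) / 4) \<tau> = qpow (- 1 / 8) \<tau> * qpow ((real (Suc n))\<^sup>2 / 2) \<tau>"
  "qpow ((2 * real n + 1)\<^sup>2 / 8) \<tau> * qpow (- (2 * real n + 1) / 4) \<tau> = qpow (- 1 / 8) \<tau> * qpow ((real n)\<^sup>2 / 2) \<tau>"
  unfolding qpow_add[symmetric] by (rule arg_cong2[where f = qpow]; simp add: field_simps power2_eq_square)+

lemma exp_half_period:
  "exp (\<i> * (of_nat (2 * n + 1) * (of_real pi * \<tau> / 2))) = qpow ((2 * real n + 1) / 4) \<tau>"
  "exp (- (\<i> * (of_nat (2 * n + 1) * (of_real pi * \<tau> / 2)))) = qpow (- (2 * real n + 1) / 4) \<tau>"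
  unfolding qpow_def by (rule arg_cong[where f = exp], simp add: field_simps)+

lemma theta1_half_pi_tau:
  assumes "Im \<tau> > 0"
  shows "theta1 (of_real pi * \<tau> / 2) \<tau> = \<i> * qpow (- 1 / 8) \<tau> * vartheta4 \<tau>"
proof -
  have "(-1) ^ n * qpow ((2 * real n + 1)\<^sup>2 / 8) \<tau> * sin (of_nat (2 * n + 1) * (of_real pi * \<tau> / 2)) =
     (\<i> / 2 * qpow (- 1 / 8) \<tau>) * ((-1) ^ Suc n * qpow ((real (Suc n))\<^sup>2 / 2) \<tau> + (-1) ^ n * qpow ((real n)\<^sup>2 / 2) \<tau>)" for n
  proof -
    have "(-1) ^ n * qpow ((2 * real n + 1)\<^sup>2 / 8) \<tau> * sin (of_nat (2 * n + 1) * (of_real pi * \<tau> / 2)) =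
       \<i> / 2 * (-1) ^ n * (qpow ((2 * real n + 1)\<^sup>2 / 8) \<tau> * qpow (- (2 * real n + 1) / 4) \<tau>
         - qpow ((2 * real n + 1)\<^sup>2 / 8) \<tau> * qpow ((2 * real n + 1) / 4) \<tau>)"
      unfolding sin_exp_eq exp_half_period by (simp add: field_simps)
    then show ?thesis
      unfolding qpow_half_period_exponents by (simp add: algebra_simps)
  qed
  with theta1_sums[OF assms, of "of_real pi * \<tau> / 2"]
  have "(\<lambda>n. (\<i> / 2 * qpow (- 1 / 8) \<tau>) * ((-1) ^ Suc n * qpow ((real (Suc n))\<^sup>2 / 2) \<tau> + (-1) ^ n * qpow ((real n)\<^sup>2 / 2) \<tau>))
     sums (theta1 (of_real pi * \<tau> / 2) \<tau> / 2)"
    by (simp only:)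
  moreover have "(\<lambda>n. (\<i> / 2 * qpow (- 1 / 8) \<tau>) * ((-1) ^ Suc n * qpow ((real (Suc n))\<^sup>2 / 2) \<tau> + (-1) ^ n * qpow ((real n)\<^sup>2 / 2) \<tau>))
     sums ((\<i> / 2 * qpow (- 1 / 8) \<tau>) * vartheta4 \<tau>)"
    unfolding vartheta4_def by (intro sums_mult sums_adjacent_square_terms assms) auto
  ultimately have "theta1 (of_real pi * \<tau> / 2) \<tau> / 2 = (\<i> / 2 * qpow (- 1 / 8) \<tau>) * vartheta4 \<tau>"
    by (rule sums_unique2)
  then show ?thesis by simp
qed

lemma theta1_half_pi_pi_tau:
  assumes "Im \<tau> > 0"
  shows "theta1 ((of_real pi + of_real pi * \<tau>) / 2) \<tau> = qpow (- 1 / 8) \<tau> * vartheta3 \<tau>"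
proof -
  have "(-1) ^ n * qpow ((2 * real n + 1)\<^sup>2 / 8) \<tau> * sin (of_nat (2 * n + 1) * ((of_real pi + of_real pi * \<tau>) / 2)) =
     (1 / 2 * qpow (- 1 / 8) \<tau>) * (1 ^ Suc n * qpow ((real (Suc n))\<^sup>2 / 2) \<tau> + 1 ^ n * qpow ((real n)\<^sup>2 / 2) \<tau>)" for n
  proof -
    have "of_nat (2 * n + 1) * ((of_real pi + of_real pi * \<tau>) / 2) =
        of_nat (2 * n + 1) * (of_real pi / 2) + of_nat (2 * n + 1) * (of_real pi * \<tau> / 2)"
      by (simp add: field_simps)
    then have "sin (of_nat (2 * n + 1) * ((of_real pi + of_real pi * \<tau>) / 2)) = (-1) ^ n * cos (of_nat (2 * n + 1) * (of_real pi * \<tau> / 2))"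
      by (simp only: sin_add sin_odd_half_pi cos_odd_half_pi) simp
    then have "(-1) ^ n * qpow ((2 * real n + 1)\<^sup>2 / 8) \<tau> * sin (of_nat (2 * n + 1) * ((of_real pi + of_real pi * \<tau>) / 2)) =
       qpow ((2 * real n + 1)\<^sup>2 / 8) \<tau> * cos (of_nat (2 * n + 1) * (of_real pi * \<tau> / 2))"
      by (simp add: mult_ac flip: power_mult_distrib)
    also have "\<dots> = 1 / 2 * (qpow ((2 * real n + 1)\<^sup>2 / 8) \<tau> * qpow ((2 * real n + 1) / 4) \<tau>
         + qpow ((2 * real n + 1)\<^sup>2 / 8) \<tau> * qpow (- (2 * real n + 1) / 4) \<tau>)"
      unfolding cos_exp_eq exp_half_period by (simp add: field_simps)
    finally show ?thesis
      unfolding qpow_half_period_exponents by (simp add: algebra_simps)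
  qed
  with theta1_sums[OF assms, of "(of_real pi + of_real pi * \<tau>) / 2"]
  have "(\<lambda>n. (1 / 2 * qpow (- 1 / 8) \<tau>) * (1 ^ Suc n * qpow ((real (Suc n))\<^sup>2 / 2) \<tau> + 1 ^ n * qpow ((real n)\<^sup>2 / 2) \<tau>))
     sums (theta1 ((of_real pi + of_real pi * \<tau>) / 2) \<tau> / 2)"
    by (simp only:)
  moreover have "(\<lambda>n. (1 / 2 * qpow (- 1 / 8) \<tau>) * (1 ^ Suc n * qpow ((real (Suc n))\<^sup>2 / 2) \<tau> + 1 ^ n * qpow ((real n)\<^sup>2 / 2) \<tau>))
     sums ((1 / 2 * qpow (- 1 / 8) \<tau>) * (1 + 2 * (\<Sum>n. 1 ^ Suc n * qpow ((real (Suc n))\<^sup>2 / 2) \<tau>)))"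
    by (intro sums_mult sums_adjacent_square_terms assms) auto
  ultimately have "theta1 ((of_real pi + of_real pi * \<tau>) / 2) \<tau> / 2 =
      (1 / 2 * qpow (- 1 / 8) \<tau>) * (1 + 2 * (\<Sum>n. 1 ^ Suc n * qpow ((real (Suc n))\<^sup>2 / 2) \<tau>))"
    by (rule sums_unique2)
  then show ?thesis
    by (simp add: vartheta3_def)
qed

section \<open>Values of theta1 at the fifths of pi\<close>

text \<open>Factor by factor this is the factorization of \<open>1 - x ^ 5\<close> over the fifth
  roots of unity, at \<open>x = q ^ Suc k\<close>.\<close>

lemma qpoch_fifth_roots:
  assumes q: "norm q < 1" and \<zeta>: "\<zeta> ^ 5 = 1" "\<zeta> \<noteq> 1"
  shows "qpoch q 1 * qpoch q \<zeta> * qpoch q (\<zeta>\<^sup>2) * qpoch q (\<zeta> ^ 3) * qpoch q (\<zeta> ^ 4) = qpoch (q ^ 5) 1"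
proof (rule LIMSEQ_unique)
  have "(\<zeta> - 1) * (1 + \<zeta> + \<zeta>\<^sup>2 + \<zeta> ^ 3 + \<zeta> ^ 4) = 0"
    using \<zeta>(1) by algebra
  then have z: "1 + \<zeta> + \<zeta>\<^sup>2 + \<zeta> ^ 3 + \<zeta> ^ 4 = 0"
    using \<zeta>(2) by simp
  have "(1 - x * 1) * (1 - x * \<zeta>) * (1 - x * \<zeta>\<^sup>2) * (1 - x * \<zeta> ^ 3) * (1 - x * \<zeta> ^ 4) = 1 - x ^ 5" for x
    using z \<zeta>(1) by algebra
  then have *: "(\<Prod>k<N. 1 - q ^ Suc k * 1) * (\<Prod>k<N. 1 - q ^ Suc k * \<zeta>) * (\<Prod>k<N. 1 - q ^ Suc k * \<zeta>\<^sup>2) *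
      (\<Prod>k<N. 1 - q ^ Suc k * \<zeta> ^ 3) * (\<Prod>k<N. 1 - q ^ Suc k * \<zeta> ^ 4) = (\<Prod>k<N. 1 - (q ^ 5) ^ Suc k * 1)" for N
    unfolding prod.distrib[symmetric] by (simp only: mult_1_right power_mult[symmetric] mult.commute[of 5])
  show "(\<lambda>N. (\<Prod>k<N. 1 - (q ^ 5) ^ Suc k * 1)) \<longlonglongrightarrow> qpoch q 1 * qpoch q \<zeta> * qpoch q (\<zeta>\<^sup>2) * qpoch q (\<zeta> ^ 3) * qpoch q (\<zeta> ^ 4)"
    unfolding *[symmetric] by (intro tendsto_intros qpoch_LIMSEQ q)
  show "(\<lambda>N. (\<Prod>k<N. 1 - (q ^ 5) ^ Suc k * 1)) \<longlonglongrightarrow> qpoch (q ^ 5) 1"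
    by (rule qpoch_LIMSEQ) (use q in \<open>auto simp: norm_power power_less_one_iff\<close>)
qed

text \<open>Doubling the angle exchanges \<open>cos (2 * pi / 5)\<close> and
  \<open>cos (4 * pi / 5)\<close>. Subtracting the two doubling formulas and cancelling
  \<open>c - d\<close>, which is nonzero by \<open>d < c\<close>, gives the sum and then the product
  of the two cosines; the sign of the square root is fixed by positivity of the sines.\<close>

lemma sin_pi_fifth_mult: "sin (pi / 5) * sin (2 * pi / 5) = sqrt 5 / 4"
proof -
  define c where "c = cos (2 * pi / 5)"
  define d where "d = cos (4 * pi / 5)"
  have "d = 2 * c\<^sup>2 - 1"
    using cos_double_cos[of "2 * pi / 5"] by (simp add: c_def d_def)
  moreover have "c = 2 * d\<^sup>2 - 1"
  proof -
    have "cos (2 * (4 * pi / 5)) = cos (2 * pi - 2 * pi / 5)"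
      by (rule arg_cong[where f = cos]) simp
    also have "\<dots> = c" unfolding c_def by (rule cos_2pi_minus)
    finally show ?thesis
      using cos_double_cos[of "4 * pi / 5"] by (simp add: d_def)
  qed
  moreover have "d < c"
    unfolding c_def d_def by (rule cos_monotone_0_pi) auto
  ultimately have cd: "c + d = - 1 / 2" "c * d = - 1 / 4"
  proof -
    assume a: "d = 2 * c\<^sup>2 - 1" "c = 2 * d\<^sup>2 - 1" "d < c"
    have "(c - d) * (2 * (c + d) + 1) = 0"
      using a(1,2) by algebra
    then show "c + d = - 1 / 2" using a(3) by simp
    then show "c * d = - 1 / 4" using a(1,2) by algebra
  qed
  have "2 * (sin (pi / 5))\<^sup>2 = 1 - c" "2 * (sin (2 * pi / 5))\<^sup>2 = 1 - d"
    using cos_double_sin[of "pi / 5"] cos_double_sin[of "2 * pi / 5"] by (simp_all add: c_def d_def)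
  then have "16 * (sin (pi / 5) * sin (2 * pi / 5))\<^sup>2 = 5"
    using cd by algebra
  then have "(4 * (sin (pi / 5) * sin (2 * pi / 5)))\<^sup>2 = 5"
    by (simp add: power_mult_distrib)
  moreover have "0 \<le> 4 * (sin (pi / 5) * sin (2 * pi / 5))"
    by (intro mult_nonneg_nonneg sin_ge_zero) auto
  ultimately have "4 * (sin (pi / 5) * sin (2 * pi / 5)) = sqrt 5"
    by (metis real_sqrt_unique)
  then show ?thesis by simp
qed

text \<open>The arguments \<open>exp (2 * \<i> * z)\<close> and their inverses at the two points are
  the four nontrivial fifth roots of unity. With one of the two copies of \<open>qpoch q 1\<close>
  they combine to the product for \<open>5 * \<tau>\<close>; the other copy goes into
  \<open>dedekind_eta \<tau>\<close>.\<close>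

lemma theta1_fifths:
  assumes "Im \<tau> > 0"
  shows "theta1 (of_real pi / 5) \<tau> * theta1 (2 * of_real pi / 5) \<tau> =
    of_real (sqrt 5) * dedekind_eta \<tau> * dedekind_eta (5 * \<tau>)"
proof -
  define q where "q = qpow 1 \<tau>"
  define \<zeta> where "\<zeta> = exp (2 * \<i> * (of_real pi / 5))"
  have q: "norm q < 1"
    using assms by (simp add: q_def norm_qpow_less_1)
  have \<zeta>5: "\<zeta> ^ 5 = 1"
    using exp_two_pi_i by (simp add: \<zeta>_def mult_ac flip: exp_of_nat_mult)
  have \<zeta>1: "\<zeta> \<noteq> 1"
  proof
    assume "\<zeta> = 1"
    then have "exp (2 * \<i> * (of_real pi / 5)) = exp 0" by (simp add: \<zeta>_def)
    then have "Re (exp (2 * \<i> * (of_real pi / 5))) = 1" by simp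
    then have "cos (2 * pi / 5) = 1" by (simp add: Re_exp)
    moreover have "cos (2 * pi / 5) < cos 0"
      by (rule cos_monotone_0_pi) auto
    ultimately show False by simp
  qed
  have e: "exp (2 * \<i> * (2 * of_real pi / 5)) = \<zeta>\<^sup>2"
    unfolding \<zeta>_def by (subst exp_double[symmetric]) (simp add: mult_ac)
  have inv: "exp (- 2 * \<i> * w) * exp (2 * \<i> * w) = 1" for w
    by (simp flip: exp_add)
  have inv_unique: "a = c" if "a * b = 1" "b * c = 1" for a b c :: complex
    using that by (metis mult.assoc mult_1 mult_1_right)
  have e': "exp (- 2 * \<i> * (of_real pi / 5)) = \<zeta> ^ 4" "exp (- 2 * \<i> * (2 * of_real pi / 5)) = \<zeta> ^ 3"
    by (rule inv_unique[OF inv], use \<zeta>5 in \<open>simp only: e flip: \<zeta>_def power_Suc power_add\<close>, simp)+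
  have "sin (complex_of_real pi / 5) * sin (2 * complex_of_real pi / 5) = of_real (sin (pi / 5) * sin (2 * pi / 5))"
    by (simp flip: sin_of_real)
  then have s: "sin (complex_of_real pi / 5) * sin (2 * complex_of_real pi / 5) = of_real (sqrt 5) / 4"
    unfolding sin_pi_fifth_mult by simp
  have q5: "qpow 1 (5 * \<tau>) = q ^ 5"
    using qpow_scale[of 1 5 \<tau>] qpow_of_nat_mult[of 5 1 \<tau>] by (simp add: q_def)
  \<comment> \<open>The powers in front match because
    \<open>1 / 8 + 1 / 8 = 1 / 24 + 5 / 24\<close>.\<close>
  have "qpow (1 / 8) \<tau> * qpow (1 / 8) \<tau> = qpow (1 / 24) \<tau> * qpow (1 / 24) (5 * \<tau>)"
    using qpow_scale[of "1/24" 5 \<tau>] by (simp flip: qpow_add)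
  then have "theta1 (of_real pi / 5) \<tau> * theta1 (2 * of_real pi / 5) \<tau> =
    4 * (qpow (1 / 24) \<tau> * qpow (1 / 24) (5 * \<tau>)) * (sin (complex_of_real pi / 5) * sin (2 * complex_of_real pi / 5))
     * qpoch q 1 * (qpoch q 1 * qpoch q \<zeta> * qpoch q (\<zeta>\<^sup>2) * qpoch q (\<zeta> ^ 3) * qpoch q (\<zeta> ^ 4))"
    unfolding theta1_product[OF assms] e e' q_def[symmetric] \<zeta>_def[symmetric] by (simp add: mult_ac)
  then show ?thesis
    unfolding qpoch_fifth_roots[OF q \<zeta>5 \<zeta>1] s dedekind_eta_qpoch q5 q_def[symmetric] by (simp add: mult_ac)
qed

section \<open>Residues of elliptic functions\<close>

lemma at_shift: "at (a + c) = filtermap (\<lambda>z. z + c) (at (a :: complex))"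
  using filtermap_at_shift[of "- c" a] by simp

lemma tendsto_at_shift:
  "(h \<longlongrightarrow> l) (at (a + c)) \<longleftrightarrow> ((\<lambda>z. h (z + c)) \<longlongrightarrow> l) (at (a :: complex))"
  unfolding at_shift filterlim_filtermap ..

lemma period_parallelogram:
  assumes "Im \<tau> > 0"
  obtains s t :: real and m n :: int where "s \<in> {0..1}" "t \<in> {0..1}"
    "z = of_real s * of_real pi + of_real t * (of_real pi * \<tau>) + (of_int m * of_real pi + of_int n * of_real pi * \<tau>)"
proof -
  define y where "y = Im z / (pi * Im \<tau>)"
  define x where "x = Re z / pi - y * Re \<tau>"
  have z: "z = of_real x * of_real pi + of_real y * (of_real pi * \<tau>)"
    using assms by (simp add: complex_eq_iff x_def y_def field_simps)
  have f: "of_real u = (of_real (frac u) + of_int \<lfloor>u\<rfloor> :: complex)" for u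
    by (simp add: frac_def)
  have "z = of_real (frac x) * of_real pi + of_real (frac y) * (of_real pi * \<tau>)
      + (of_int \<lfloor>x\<rfloor> * of_real pi + of_int \<lfloor>y\<rfloor> * of_real pi * \<tau>)"
    by (subst z, subst f[of x], subst f[of y]) (simp add: algebra_simps)
  moreover have "frac x \<in> {0..1}" "frac y \<in> {0..1}"
    using frac_lt_1[of x] frac_lt_1[of y] by (auto simp: less_imp_le)
  ultimately show ?thesis using that by blast
qed

text \<open>All values are already taken on the closed period parallelogram, which is compact;
  Liouville's theorem applies.\<close>

lemma doubly_periodic_entire_constant:
  assumes tau: "Im \<tau> > 0" and hol: "F holomorphic_on UNIV"
    and per: "\<And>z. F (z + of_real pi) = F z" "\<And>z. F (z + of_real pi * \<tau>) = F z"
  shows "F constant_on UNIV"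
proof (rule Liouville_theorem[OF hol])
  define e where "e = (\<lambda>(s, t). of_real s * of_real pi + of_real t * (of_real pi * \<tau>) :: complex)"
  have "continuous_on UNIV F"
    using hol by (rule holomorphic_on_imp_continuous_on)
  then have "continuous_on ({0..1} \<times> {0..1}) (\<lambda>x. F (e x))"
    by (rule continuous_on_compose2) (auto simp: e_def case_prod_unfold intro!: continuous_intros)
  then have "bounded ((\<lambda>x. F (e x)) ` ({0..1} \<times> {0..1}))"
    by (intro compact_imp_bounded compact_continuous_image compact_Times compact_Icc)
  moreover have "range F \<subseteq> (\<lambda>x. F (e x)) ` ({0..1} \<times> {0..1})"
  proof
    fix w assume "w \<in> range F"
    then obtain z where w: "w = F z" by blast
    obtain s t :: real and m n :: int where st: "s \<in> {0..1}" "t \<in> {0..1}"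
      "z = of_real s * of_real pi + of_real t * (of_real pi * \<tau>) + (of_int m * of_real pi + of_int n * of_real pi * \<tau>)"
      by (rule period_parallelogram[OF tau])
    have "F z = F (e (s, t))"
      unfolding st(3) e_def prod.case by (rule lattice_invariant[where Q = F, OF per])
    with st w show "w \<in> (\<lambda>x. F (e x)) ` ({0..1} \<times> {0..1})" by auto
  qed
  ultimately show "bounded (range F)"
    by (rule bounded_subset)
qed

text \<open>The derivative loses the additive constant, so it is doubly periodic and therefore
  constant. Thus \<open>F\<close> is affine, the period \<open>pi\<close> makes its slope 0, and
  \<open>K\<close> is the slope times \<open>pi * \<tau>\<close>.\<close>

lemma quasi_periodic_entire:
  assumes tau: "Im \<tau> > 0" and hol: "F holomorphic_on UNIV"
    and per: "\<And>z. F (z + of_real pi) = F z" "\<And>z. F (z + of_real pi * \<tau>) = F z + K"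
  shows "K = 0"
proof -
  have D: "(F has_field_derivative deriv F z) (at z)" for z
    using hol by (rule holomorphic_derivI) auto
  have 1: "deriv F (z + of_real pi) = deriv F z" for z
  proof (rule DERIV_unique)
    show "(F has_field_derivative deriv F z) (at z)" by (rule D)
    show "(F has_field_derivative deriv F (z + of_real pi)) (at z)"
      using D[of "z + of_real pi", unfolded DERIV_shift per] .
  qed
  have 2: "deriv F (z + of_real pi * \<tau>) = deriv F z" for z
  proof (rule DERIV_unique)
    show "((\<lambda>z. F z + K) has_field_derivative deriv F z) (at z)"
      using D[of z] by (auto intro!: derivative_eq_intros)
    show "((\<lambda>z. F z + K) has_field_derivative deriv F (z + of_real pi * \<tau>)) (at z)"
      using D[of "z + of_real pi * \<tau>", unfolded DERIV_shift per] .
  qed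
  have "deriv F constant_on UNIV"
    by (rule doubly_periodic_entire_constant[OF tau _ 1 2]) (use hol in \<open>auto intro: holomorphic_deriv\<close>)
  then obtain a where a: "\<And>z. deriv F z = a"
    by (auto simp: constant_on_def)
  have "((\<lambda>z. F z - a * z) has_field_derivative 0) (at z)" for z
    using D[of z] unfolding a by (auto intro!: derivative_eq_intros)
  then have "\<exists>b. \<forall>z\<in>UNIV. F z - a * z = b"
    by (intro has_field_derivative_zero_constant) auto
  then obtain b where "\<And>z. F z = a * z + b"
    by (auto simp: algebra_simps)
  with per(1)[of 0] per(2)[of 0] show ?thesis by simp
qed

text \<open>Riemann's theorem supplies extensions on small discs only. Defining \<open>F\<close>
  through limits of \<open>h\<close> makes them agree, and frees \<open>F\<close> from the default
  values that \<open>h\<close> has on \<open>S\<close>.\<close>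

lemma extend_over_removable_singularities:
  assumes sing: "\<And>z0. \<forall>\<^sub>F z in at z0. z \<notin> S" and op: "open (- S)" and hol: "h holomorphic_on - S"
    and lim: "\<And>z0. z0 \<in> S \<Longrightarrow> ((\<lambda>z. (z - z0) * h z) \<longlongrightarrow> 0) (at z0)"
  obtains F where "F holomorphic_on UNIV" "\<And>z. (h \<longlongrightarrow> F z) (at z)"
proof -
  define F where "F z = Lim (at z) h" for z
  have local: "\<exists>e>0. F holomorphic_on ball z0 e \<and> (\<forall>w\<in>ball z0 e. (h \<longlongrightarrow> F w) (at w))" for z0
  proof -
    obtain e where e: "e > 0" "\<And>z. z \<in> ball z0 e \<Longrightarrow> z \<noteq> z0 \<Longrightarrow> z \<notin> S"
      using sing[of z0] by (auto simp: eventually_at dist_commute)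
    have hol': "h holomorphic_on ball z0 e - {z0}"
      using hol by (rule holomorphic_on_subset) (use e in auto)
    have "((\<lambda>z. (z - z0) * h z) \<longlongrightarrow> 0) (at z0)"
    proof (cases "z0 \<in> S")
      case False
      then have "isCont h z0"
        using hol op by (intro continuous_on_interior[OF holomorphic_on_imp_continuous_on]) (auto simp: interior_open)
      then have "((\<lambda>z. (z - z0) * h z) \<longlongrightarrow> (z0 - z0) * h z0) (at z0)"
        by (intro tendsto_intros) (simp add: isCont_def)
      then show ?thesis by simp
    qed (rule lim)
    then obtain k where k: "k holomorphic_on ball z0 e" "\<And>z. z \<in> ball z0 e - {z0} \<Longrightarrow> k z = h z"
      using holomorphic_on_extend_lim[OF hol'] e(1) by (auto simp: interior_open)
    have w: "(h \<longlongrightarrow> k w) (at w)" if "w \<in> ball z0 e" for w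
    proof -
      have "isCont k w"
        using k(1) that by (intro continuous_on_interior[OF holomorphic_on_imp_continuous_on]) (auto simp: interior_open)
      then have "(k \<longlongrightarrow> k w) (at w)" by (simp add: isCont_def)
      moreover have "\<forall>\<^sub>F z in at w. k z = h z"
      proof -
        have "\<forall>\<^sub>F z in at w. z \<in> ball z0 e"
          using that by (intro eventually_at_in_open') auto
        moreover have "\<forall>\<^sub>F z in at w. z \<noteq> z0"
          by (rule eventually_neq_at_within)
        ultimately show ?thesis
          by eventually_elim (use k in auto)
      qed
      ultimately show ?thesis by (simp add: tendsto_cong)
    qed
    then have Fk: "F w = k w" if "w \<in> ball z0 e" for w
      unfolding F_def using that by (intro tendsto_Lim) auto
    then have "F holomorphic_on ball z0 e"
      by (intro holomorphic_transform[OF k(1)]) auto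
    then show ?thesis
      using w e(1) Fk by (intro exI[of _ e]) auto
  qed
  have "F analytic_on UNIV"
    unfolding analytic_on_def using local by blast
  then have "F holomorphic_on UNIV"
    by (rule analytic_imp_holomorphic)
  moreover have "(h \<longlongrightarrow> F z) (at z)" for z
    using local[of z] by auto
  ultimately show ?thesis using that by blast
qed

lemma deriv_theta1_plus_pi:
  assumes "Im \<tau> > 0"
  shows "deriv (\<lambda>z. theta1 z \<tau>) (z + of_real pi) = - deriv (\<lambda>z. theta1 z \<tau>) z"
proof (rule DERIV_unique)
  have D: "((\<lambda>z. theta1 z \<tau>) has_field_derivative deriv (\<lambda>z. theta1 z \<tau>) z) (at z)" for z
    using holomorphic_theta1[OF assms, of UNIV] by (rule holomorphic_derivI) auto
  show "((\<lambda>z. - theta1 z \<tau>) has_field_derivative deriv (\<lambda>z. theta1 z \<tau>) (z + of_real pi)) (at z)"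
    using D[of "z + of_real pi", unfolded DERIV_shift theta1_plus_pi[OF assms]] .
  show "((\<lambda>z. - theta1 z \<tau>) has_field_derivative - deriv (\<lambda>z. theta1 z \<tau>) z) (at z)"
    using D[of z] by (rule DERIV_minus)
qed

lemma deriv_theta1_plus_pi_tau:
  assumes "Im \<tau> > 0"
  shows "deriv (\<lambda>z. theta1 z \<tau>) (z + of_real pi * \<tau>) =
    - qpow (- 1 / 2) \<tau> * exp (- 2 * \<i> * z) * (deriv (\<lambda>z. theta1 z \<tau>) z - 2 * \<i> * theta1 z \<tau>)"
proof (rule DERIV_unique)
  have D: "((\<lambda>z. theta1 z \<tau>) has_field_derivative deriv (\<lambda>z. theta1 z \<tau>) z) (at z)" for z
    using holomorphic_theta1[OF assms, of UNIV] by (rule holomorphic_derivI) auto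
  show "((\<lambda>z. - qpow (- 1 / 2) \<tau> * exp (- 2 * \<i> * z) * theta1 z \<tau>) has_field_derivative
      deriv (\<lambda>z. theta1 z \<tau>) (z + of_real pi * \<tau>)) (at z)"
    using D[of "z + of_real pi * \<tau>", unfolded DERIV_shift theta1_plus_pi_tau[OF assms]] .
  show "((\<lambda>z. - qpow (- 1 / 2) \<tau> * exp (- 2 * \<i> * z) * theta1 z \<tau>) has_field_derivative
    - qpow (- 1 / 2) \<tau> * exp (- 2 * \<i> * z) * (deriv (\<lambda>z. theta1 z \<tau>) z - 2 * \<i> * theta1 z \<tau>)) (at z)"
    using D[of z] by (auto intro!: derivative_eq_intros simp: algebra_simps)
qed

lemma tendsto_theta1_over_id:
  assumes "Im \<tau> > 0"
  shows "((\<lambda>z. theta1 z \<tau> / z) \<longlongrightarrow> 2 * dedekind_eta \<tau> ^ 3) (at 0)"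
  using theta1_has_derivative_0[OF assms] by (simp add: DERIV_def)

lemma isCont_theta1:
  assumes "Im \<tau> > 0"
  shows "isCont (\<lambda>z. theta1 z \<tau>) z"
  using holomorphic_theta1[OF assms, of UNIV] holomorphic_on_imp_continuous_on continuous_on_eq_continuous_at
  by blast

text \<open>Zeros are isolated, since \<open>theta1\<close> is not identically zero: its derivative
  at 0 is \<open>2 * dedekind_eta \<tau> ^ 3\<close>.\<close>

lemma eventually_theta1_nonzero:
  assumes "Im \<tau> > 0"
  shows "\<forall>\<^sub>F z in at z0. theta1 (z - p) \<tau> \<noteq> 0"
proof -
  have "\<exists>w. theta1 w \<tau> \<noteq> 0"
  proof (rule ccontr)
    assume "\<not> ?thesis"
    then have "((\<lambda>z. theta1 z \<tau>) has_field_derivative 0) (at 0)" by simp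
    with theta1_has_derivative_0[OF assms] have "2 * dedekind_eta \<tau> ^ 3 = 0"
      by (rule DERIV_unique)
    then show False using dedekind_eta_nonzero[OF assms] by simp
  qed
  then obtain w where w: "theta1 w \<tau> \<noteq> 0" by blast
  have "(\<lambda>z. theta1 (z - p) \<tau>) holomorphic_on UNIV"
    by (rule holomorphic_on_compose_gen[OF _ holomorphic_theta1[OF assms], unfolded o_def, of _ _ UNIV])
       (auto intro!: holomorphic_intros)
  from non_zero_neighbour_alt[OF this open_UNIV connected_UNIV, of z0 "w + p"] w show ?thesis
    by simp
qed

text \<open>Subtracting \<open>r p\<close> times the logarithmic derivative of \<open>theta1\<close> at \<open>z - p\<close> removes every pole,
  and the entire function that remains picks up \<open>2\<i>\<close> times the sum of the residues under \<open>z \<mapsto> z + \<pi>\<tau>\<close>.\<close>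
lemma sum_residues_eq_0:
  fixes g :: "complex \<Rightarrow> complex"
  assumes tau: "Im \<tau> > 0" and P: "finite P"
    and incong: "\<And>p p'. p \<in> P \<Longrightarrow> p' \<in> P \<Longrightarrow> theta1 (p - p') \<tau> = 0 \<Longrightarrow> p = p'"
    and hol: "g holomorphic_on {z. \<forall>p\<in>P. theta1 (z - p) \<tau> \<noteq> 0}"
    and per: "\<And>z. g (z + of_real pi) = g z" "\<And>z. g (z + of_real pi * \<tau>) = g z"
    and res: "\<And>p. p \<in> P \<Longrightarrow> ((\<lambda>z. (z - p) * g z) \<longlongrightarrow> r p) (at p)"
  shows "(\<Sum>p\<in>P. r p) = 0"
proof -
  define \<theta> where "\<theta> z = theta1 z \<tau>" for z
  define Z where "Z z = deriv \<theta> z / \<theta> z" for z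
  define S where "S = {z. \<exists>p\<in>P. \<theta> (z - p) = 0}"
  define h where "h z = g z - (\<Sum>p\<in>P. r p * Z (z - p))" for z
  define R where "R = (\<Sum>p\<in>P. r p)"
  have \<theta>: "\<theta> = (\<lambda>z. theta1 z \<tau>)" by (simp add: \<theta>_def fun_eq_iff)
  have hol\<theta>: "\<theta> holomorphic_on A" for A
    unfolding \<theta> by (rule holomorphic_theta1[OF tau])
  have hol_shift: "(\<lambda>z. \<theta> (z - p)) holomorphic_on A" "(\<lambda>z. deriv \<theta> (z - p)) holomorphic_on A" for p A
    by (rule holomorphic_on_compose_gen[OF _ hol\<theta>, unfolded o_def, of _ _ UNIV],
        auto intro!: holomorphic_intros)
      (rule holomorphic_on_compose_gen[OF _ holomorphic_deriv[OF hol\<theta> open_UNIV], unfolded o_def],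
        auto intro!: holomorphic_intros)
  have cont: "isCont \<theta> z" "isCont (deriv \<theta>) z" for z
    using hol\<theta>[of UNIV] holomorphic_deriv[OF hol\<theta>[of UNIV]] holomorphic_on_imp_continuous_on continuous_on_eq_continuous_at
    by blast+
  have Z1: "Z (z + of_real pi) = Z z" for z
    unfolding Z_def \<theta> deriv_theta1_plus_pi[OF tau] theta1_plus_pi[OF tau] by simp
  \<comment> \<open>At a zero of \<open>\<theta>\<close> division by 0 makes both values of
    \<open>Z\<close> equal to 0, so the shift law holds only away from the zeros.\<close>
  have Z2: "Z (z + of_real pi * \<tau>) = Z z - 2 * \<i>" if "\<theta> z \<noteq> 0" for z
    using that unfolding Z_def \<theta> deriv_theta1_plus_pi_tau[OF tau] theta1_plus_pi_tau[OF tau]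
    by (simp add: diff_divide_distrib)
  have h1: "h (z + of_real pi) = h z" for z
    using Z1[of "z - p" for p] by (simp add: h_def per add_diff_eq[symmetric] diff_add_eq)
  have h2: "h (z + of_real pi * \<tau>) = h z + 2 * \<i> * R" if "z \<notin> S" for z
  proof -
    have "(\<Sum>p\<in>P. r p * Z (z + of_real pi * \<tau> - p)) = (\<Sum>p\<in>P. r p * Z (z - p) - 2 * \<i> * r p)"
    proof (intro sum.cong refl)
      fix p assume "p \<in> P"
      then have "\<theta> (z - p) \<noteq> 0" using that by (auto simp: S_def)
      then have "Z (z + of_real pi * \<tau> - p) = Z (z - p) - 2 * \<i>"
        using Z2[of "z - p"] by (simp add: diff_add_eq)
      then show "r p * Z (z + of_real pi * \<tau> - p) = r p * Z (z - p) - 2 * \<i> * r p"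
        by (simp add: right_diff_distrib)
    qed
    then show ?thesis
      by (simp add: h_def per R_def sum_subtractf sum_distrib_left)
  qed
  have sing: "\<forall>\<^sub>F z in at z0. z \<notin> S" for z0
    using eventually_ball_finite[OF P, of "\<lambda>z p. \<theta> (z - p) \<noteq> 0" "at z0"] eventually_theta1_nonzero[OF tau]
    by (simp add: S_def \<theta>_def)
  have S_eq: "- S = {z. \<forall>p\<in>P. theta1 (z - p) \<tau> \<noteq> 0}"
    by (auto simp: S_def \<theta>_def)
  have op: "open (- S)"
  proof -
    have "- S = (\<Inter>p\<in>P. {z. \<theta> (z - p) \<noteq> 0})"
      by (auto simp: S_def)
    moreover have "open {z. \<theta> (z - p) \<noteq> 0}" for p
      by (intro open_Collect_neq holomorphic_on_imp_continuous_on[OF hol_shift(1)] continuous_on_const)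
    ultimately show ?thesis using P by (simp add: open_INT)
  qed
  have holZ: "(\<lambda>z. Z (z - p)) holomorphic_on - S" if "p \<in> P" for p
  proof -
    show ?thesis
      unfolding Z_def by (rule holomorphic_on_divide[OF hol_shift(2,1)]) (use that in \<open>auto simp: S_def\<close>)
  qed
  have holh: "h holomorphic_on - S"
    unfolding h_def using hol S_eq by (intro holomorphic_intros holZ) auto
  \<comment> \<open>\<open>C z0\<close> says that the singularity of \<open>h\<close> at
    \<open>z0\<close> is removable. It is invariant under the lattice, hence only the
    representatives in \<open>P\<close> need a computation.\<close>
  define C where "C z0 \<longleftrightarrow> ((\<lambda>z. (z - z0) * h z) \<longlongrightarrow> 0) (at z0)" for z0
  \<comment> \<open>The additive constant is harmless because \<open>(z - z0) * K\<close> tends to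
    0. Both periods are covered, with \<open>K = 0\<close> and
    \<open>K = 2 * \<i> * R\<close>.\<close>
  have shift: "C (z0 + c) \<longleftrightarrow> C z0" if "\<And>z. z \<notin> S \<Longrightarrow> h (z + c) = h z + K" for z0 c K
  proof -
    have "C (z0 + c) \<longleftrightarrow> ((\<lambda>z. (z - z0) * h (z + c)) \<longlongrightarrow> 0) (at z0)"
      unfolding C_def tendsto_at_shift by simp
    also have "\<dots> \<longleftrightarrow> ((\<lambda>z. (z - z0) * h z + (z - z0) * K) \<longlongrightarrow> 0) (at z0)"
      by (intro tendsto_cong eventually_mono[OF sing[of z0]]) (simp add: that distrib_left)
    also have "\<dots> \<longleftrightarrow> C z0"
    proof -
      have K: "((\<lambda>z. (z - z0) * K) \<longlongrightarrow> 0) (at z0)"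
        by (rule tendsto_eq_intros refl | simp)+
      show ?thesis
        unfolding C_def using tendsto_add[OF _ K, of _ 0] tendsto_diff[OF _ K, of _ 0] by fastforce
    qed
    finally show ?thesis .
  qed
  have CP: "C p" if p: "p \<in> P" for p
  proof -
    have "((\<lambda>z. (z - p) * Z (z - p')) \<longlongrightarrow> (if p' = p then 1 else 0)) (at p)" if p': "p' \<in> P" for p'
    proof (cases "p' = p")
      case True
      \<comment> \<open>The logarithmic derivative has residue 1 at 0: numerator and denominator
        tend to the same nonzero number, the derivative of \<open>\<theta>\<close> at 0.\<close>
      have "((\<lambda>z. deriv \<theta> z / (\<theta> z / z)) \<longlongrightarrow> deriv \<theta> 0 / (2 * dedekind_eta \<tau> ^ 3)) (at 0)"
        using tendsto_theta1_over_id[OF tau] cont(2)[of 0] dedekind_eta_nonzero[OF tau]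
        by (intro tendsto_divide) (auto simp: isCont_def \<theta>_def)
      moreover have "deriv \<theta> 0 = 2 * dedekind_eta \<tau> ^ 3"
        unfolding \<theta> by (rule DERIV_imp_deriv[OF theta1_has_derivative_0[OF tau]])
      ultimately have "((\<lambda>z. z * Z z) \<longlongrightarrow> 1) (at 0)"
        using dedekind_eta_nonzero[OF tau] by (simp add: Z_def mult.commute)
      then show ?thesis
        using tendsto_at_shift[of "\<lambda>z. (z - p) * Z (z - p)" 1 0 p] True by simp
    next
      case False
      then have nz: "\<theta> (p - p') \<noteq> 0"
        using incong[OF p p'] by (auto simp: \<theta>_def)
      have "isCont (\<lambda>z. \<theta> (z - p')) p" "isCont (\<lambda>z. deriv \<theta> (z - p')) p"
        by (rule isCont_o2[OF _ cont(1)] isCont_o2[OF _ cont(2)], simp)+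
      then have "((\<lambda>z. (z - p) * Z (z - p')) \<longlongrightarrow> (p - p) * Z (p - p')) (at p)"
        unfolding Z_def using nz by (intro tendsto_intros) (auto simp: isCont_def)
      then show ?thesis using False by simp
    qed
    then have "((\<lambda>z. (z - p) * g z - (\<Sum>p'\<in>P. r p' * ((z - p) * Z (z - p')))) \<longlongrightarrow>
        r p - (\<Sum>p'\<in>P. r p' * (if p' = p then 1 else 0))) (at p)"
      by (intro tendsto_intros res p)
    moreover have "(\<Sum>p'\<in>P. r p' * (if p' = p then 1 else 0)) = r p"
      using P p by (simp add: if_distrib sum.delta cong: if_cong)
    ultimately show ?thesis
      by (simp add: C_def h_def right_diff_distrib sum_distrib_left mult_ac)
  qed
  have CS: "C z0" if z0: "z0 \<in> S" for z0
  proof -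
    obtain p m n where p: "p \<in> P" "z0 = p + (of_int m * of_real pi + of_int n * of_real pi * \<tau>)"
      using z0 by (auto simp: S_def \<theta>_def theta1_eq_0_iff[OF tau] diff_eq_eq add.commute)
    have "C (p + (of_int m * of_real pi + of_int n * of_real pi * \<tau>)) = C p"
      by (rule lattice_invariant[where Q = C]) (use shift[of _ 0] shift h1 h2 in auto)
    with CP[OF p(1)] p(2) show ?thesis by simp
  qed
  obtain F where F: "F holomorphic_on UNIV" "\<And>z. (h \<longlongrightarrow> F z) (at z)"
    using extend_over_removable_singularities[OF sing op holh] CS unfolding C_def by blast
  have F_shift: "F (z + c) = F z + K" if "\<And>z. z \<notin> S \<Longrightarrow> h (z + c) = h z + K" for z c K
  proof (rule tendsto_unique[OF at_neq_bot])
    show "((\<lambda>z. h (z + c)) \<longlongrightarrow> F (z + c)) (at z)"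
      using F(2)[of "z + c"] unfolding tendsto_at_shift .
    have "((\<lambda>z. h z + K) \<longlongrightarrow> F z + K) (at z)"
      by (intro tendsto_intros F(2))
    moreover have "\<forall>\<^sub>F z in at z. h z + K = h (z + c)"
      using sing by eventually_elim (simp add: that)
    ultimately show "((\<lambda>z. h (z + c)) \<longlongrightarrow> F z + K) (at z)"
      by (rule Lim_transform_eventually)
  qed
  have "2 * \<i> * R = 0"
    by (rule quasi_periodic_entire[OF tau F(1)]) (use F_shift[of _ 0] F_shift h1 h2 in auto)
  then show ?thesis by (simp add: R_def)
qed

section \<open>The elliptic function attached to f\<close>

lemma theta1_lattice_coordinates_eq_0_iff:
  assumes "Im \<tau> > 0"
  shows "theta1 (of_real a * of_real pi + of_real b * (of_real pi * \<tau>)) \<tau> = 0 \<longleftrightarrow> a \<in> \<int> \<and> b \<in> \<int>"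
proof
  assume "theta1 (of_real a * of_real pi + of_real b * (of_real pi * \<tau>)) \<tau> = 0"
  then obtain m n :: int where e: "of_real a * of_real pi + of_real b * (of_real pi * \<tau>) = of_int m * of_real pi + of_int n * of_real pi * \<tau>"
    unfolding theta1_eq_0_iff[OF assms] by blast
  from arg_cong[OF e, of Im] assms have b: "b = of_int n"
    by simp
  from arg_cong[OF e, of Re] have "a = of_int m"
    unfolding b by simp
  with b show "a \<in> \<int> \<and> b \<in> \<int>" by simp
next
  assume "a \<in> \<int> \<and> b \<in> \<int>"
  then obtain m n :: int where "a = of_int m" "b = of_int n"
    by (auto elim!: Ints_cases)
  then show "theta1 (of_real a * of_real pi + of_real b * (of_real pi * \<tau>)) \<tau> = 0"
    unfolding theta1_eq_0_iff[OF assms] by (auto simp: mult.assoc)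
qed

lemma not_Ints_between_0_1: "0 < x \<Longrightarrow> x < 1 \<Longrightarrow> (x :: real) \<notin> \<int>"
  by (auto elim!: Ints_cases)

lemma theta1_plus_of_nat_pi:
  assumes "Im \<tau> > 0"
  shows "theta1 (z + of_nat n * of_real pi) \<tau> = (-1) ^ n * theta1 z \<tau>"
proof (induction n)
  case (Suc n)
  then show ?case
    using theta1_plus_pi[OF assms, of "z + of_nat n * of_real pi"] by (simp add: algebra_simps)
qed simp

lemma tendsto_theta1_scaled_over_id:
  assumes "Im \<tau> > 0"
  shows "((\<lambda>u. theta1 (c * u) \<tau> / u) \<longlongrightarrow> c * (2 * dedekind_eta \<tau> ^ 3)) (at 0)"
proof -
  have "((\<lambda>u. c * u) has_field_derivative c) (at 0)"
    by (auto intro!: derivative_eq_intros)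
  then have "((\<lambda>u. theta1 (c * u) \<tau>) has_field_derivative 2 * dedekind_eta \<tau> ^ 3 * c) (at 0)"
    using theta1_has_derivative_0[OF assms]
      DERIV_chain2[of "\<lambda>u. theta1 u \<tau>" "2 * dedekind_eta \<tau> ^ 3" "\<lambda>u. c * u" 0 c] by simp
  then show ?thesis
    by (simp add: DERIV_def mult_ac)
qed

lemma tendsto_theta1_shift:
  assumes "Im \<tau> > 0"
  shows "((\<lambda>u. theta1 (c * u + d) \<tau>) \<longlongrightarrow> theta1 d \<tau>) (at 0)"
proof -
  have "((\<lambda>u. c * u + d) \<longlongrightarrow> d) (at 0)"
    by (rule tendsto_eq_intros refl | simp)+
  then show ?thesis
    by (rule isCont_tendsto_compose[OF isCont_theta1[OF assms]])
qed

section \<open>Periods and residues of the kernel\<close>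

context
  fixes \<tau> :: complex and f :: "complex \<Rightarrow> complex"
  assumes tau: "Im \<tau> > 0"
    and entire: "f holomorphic_on UNIV"
begin

definition res_kernel :: "complex \<Rightarrow> complex" where
  "res_kernel z = f z * theta1 z \<tau> / (theta1 (2 * z) \<tau> * theta1 (5 * z) (5 * \<tau>))"

lemma Im_5_mult_pos: "Im (5 * \<tau>) > 0"
  using tau by simp

lemma tendsto_f_shift: "((\<lambda>u. f (u + d)) \<longlongrightarrow> f d) (at 0)"
proof -
  have "isCont f d"
    using entire holomorphic_on_imp_continuous_on continuous_on_eq_continuous_at by blast
  then have "(f \<longlongrightarrow> f (0 + d)) (at (0 + d))" by (simp add: isCont_def)
  then show ?thesis
    unfolding tendsto_at_shift by simp
qed

text \<open>Numerator and both denominator factors have simple zeros at 0. Dividing each by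
  \<open>z\<close> leaves the scalings 1, 2 and 5 times \<open>2 * dedekind_eta ^ 3\<close>, and the
  cubes at \<open>\<tau>\<close> cancel.\<close>

lemma res_kernel_residue_0:
  "((\<lambda>z. (z - 0) * res_kernel z) \<longlongrightarrow> f 0 / (20 * dedekind_eta (5 * \<tau>) ^ 3)) (at 0)"
proof -
  have nz: "dedekind_eta \<tau> \<noteq> 0" "dedekind_eta (5 * \<tau>) \<noteq> 0"
    using tau by (auto intro!: dedekind_eta_nonzero)
  have "((\<lambda>z. f (z + 0) * (theta1 (1 * z) \<tau> / z) / ((theta1 (2 * z) \<tau> / z) * (theta1 (5 * z) (5 * \<tau>) / z))) \<longlongrightarrow>
     f 0 * (1 * (2 * dedekind_eta \<tau> ^ 3)) / ((2 * (2 * dedekind_eta \<tau> ^ 3)) * (5 * (2 * dedekind_eta (5 * \<tau>) ^ 3)))) (at 0)"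
    using nz by (intro tendsto_intros tendsto_f_shift tendsto_theta1_scaled_over_id tau Im_5_mult_pos) auto
  moreover have "f 0 * (1 * (2 * dedekind_eta \<tau> ^ 3)) / ((2 * (2 * dedekind_eta \<tau> ^ 3)) * (5 * (2 * dedekind_eta (5 * \<tau>) ^ 3)))
      = f 0 / (20 * dedekind_eta (5 * \<tau>) ^ 3)"
    using nz by (simp add: field_simps)
  moreover have "\<forall>\<^sub>F z in at 0. f (z + 0) * (theta1 (1 * z) \<tau> / z) / ((theta1 (2 * z) \<tau> / z) * (theta1 (5 * z) (5 * \<tau>) / z))
      = (z - 0) * res_kernel z"
    using eventually_neq_at_within[of 0 0 UNIV] by eventually_elim (simp add: res_kernel_def field_simps)
  ultimately show ?thesis
    by (simp add: tendsto_cong)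
qed

text \<open>Here \<open>2 * p\<close> is a period, and \<open>M\<close> is the multiplier of
  \<open>theta1\<close> for translation by it; this moves the zero of
  \<open>theta1 (2 * z) \<tau>\<close> at \<open>p\<close> to 0, where the derivative is
  known.\<close>

lemma res_kernel_residue_half_period:
  assumes M: "\<And>u. theta1 (2 * u + 2 * p) \<tau> = M u * theta1 (2 * u) \<tau>" "isCont M 0" "M 0 \<noteq> 0"
    and nz5: "theta1 (5 * p) (5 * \<tau>) \<noteq> 0"
  shows "((\<lambda>z. (z - p) * res_kernel z) \<longlongrightarrow>
    f p * theta1 p \<tau> / (M 0 * (4 * dedekind_eta \<tau> ^ 3) * theta1 (5 * p) (5 * \<tau>))) (at p)"
proof -
  have nz: "dedekind_eta \<tau> \<noteq> 0"
    using tau by (rule dedekind_eta_nonzero)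
  have "((\<lambda>u. f (u + p) * theta1 (1 * u + p) \<tau> / (M u * (theta1 (2 * u) \<tau> / u) * theta1 (5 * u + 5 * p) (5 * \<tau>))) \<longlongrightarrow>
     f p * theta1 p \<tau> / (M 0 * (2 * (2 * dedekind_eta \<tau> ^ 3)) * theta1 (5 * p) (5 * \<tau>))) (at 0)"
    using nz nz5 M(2,3)
    by (intro tendsto_intros tendsto_f_shift tendsto_theta1_scaled_over_id tendsto_theta1_shift tau Im_5_mult_pos)
       (auto simp: isCont_def)
  moreover have "\<forall>\<^sub>F u in at 0. f (u + p) * theta1 (1 * u + p) \<tau> / (M u * (theta1 (2 * u) \<tau> / u) * theta1 (5 * u + 5 * p) (5 * \<tau>))
      = (u + p - p) * res_kernel (u + p)"
    using eventually_neq_at_within[of 0 0 UNIV]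
    by eventually_elim (simp add: res_kernel_def M(1) distrib_left)
  ultimately show ?thesis
    using tendsto_at_shift[of "\<lambda>z. (z - p) * res_kernel z" _ 0 p] by (simp add: tendsto_cong)
qed

text \<open>Now the pole comes from \<open>theta1 (5 * z) (5 * \<tau>)\<close>; translation by
  \<open>n\<close> times \<open>pi\<close> brings its zero to 0 at the cost of the sign
  \<open>(-1) ^ n\<close>.\<close>

lemma res_kernel_residue_fifth:
  assumes p: "5 * p = of_nat n * of_real pi" and nz2: "theta1 (2 * p) \<tau> \<noteq> 0"
  shows "((\<lambda>z. (z - p) * res_kernel z) \<longlongrightarrow>
    f p * theta1 p \<tau> / (theta1 (2 * p) \<tau> * (-1) ^ n * (10 * dedekind_eta (5 * \<tau>) ^ 3))) (at p)"
proof -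
  have nz: "dedekind_eta (5 * \<tau>) \<noteq> 0"
    using Im_5_mult_pos by (rule dedekind_eta_nonzero)
  have "((\<lambda>u. f (u + p) * theta1 (1 * u + p) \<tau> / (theta1 (2 * u + 2 * p) \<tau> * (-1) ^ n * (theta1 (5 * u) (5 * \<tau>) / u))) \<longlongrightarrow>
     f p * theta1 p \<tau> / (theta1 (2 * p) \<tau> * (-1) ^ n * (5 * (2 * dedekind_eta (5 * \<tau>) ^ 3)))) (at 0)"
    using nz nz2
    by (intro tendsto_intros tendsto_f_shift tendsto_theta1_scaled_over_id tendsto_theta1_shift tau Im_5_mult_pos) auto
  moreover have "\<forall>\<^sub>F u in at 0. f (u + p) * theta1 (1 * u + p) \<tau> / (theta1 (2 * u + 2 * p) \<tau> * (-1) ^ n * (theta1 (5 * u) (5 * \<tau>) / u))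
      = (u + p - p) * res_kernel (u + p)"
    using eventually_neq_at_within[of 0 0 UNIV]
    by eventually_elim (simp add: res_kernel_def distrib_left p theta1_plus_of_nat_pi[OF Im_5_mult_pos], simp add: mult_ac)
  ultimately show ?thesis
    using tendsto_at_shift[of "\<lambda>z. (z - p) * res_kernel z" _ 0 p] by (simp add: tendsto_cong)
qed

lemma holomorphic_res_kernel:
  assumes "\<And>z. z \<in> A \<Longrightarrow> theta1 (2 * z) \<tau> \<noteq> 0" "\<And>z. z \<in> A \<Longrightarrow> theta1 (5 * z) (5 * \<tau>) \<noteq> 0"
  shows "res_kernel holomorphic_on A"
proof -
  have "(\<lambda>z. theta1 (c * z) \<sigma>) holomorphic_on A" if "Im \<sigma> > 0" for c \<sigma>
    by (rule holomorphic_on_compose_gen[OF _ holomorphic_theta1[OF that], unfolded o_def, of _ _ UNIV])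
       (auto intro!: holomorphic_intros)
  moreover have "f holomorphic_on A"
    using entire by (rule holomorphic_on_subset) simp
  ultimately show ?thesis
    unfolding res_kernel_def[abs_def] using tau Im_5_mult_pos assms
    by (intro holomorphic_intros holomorphic_theta1) auto
qed

lemma res_kernel_plus_pi:
  assumes "\<forall>z. f z = f (z + of_real pi)"
  shows "res_kernel (z + of_real pi) = res_kernel z"
proof -
  have "theta1 (2 * (z + of_real pi)) \<tau> = theta1 (2 * z) \<tau>"
    using theta1_plus_of_nat_pi[OF tau, of "2 * z" 2] by (simp add: distrib_left)
  moreover have "theta1 (5 * (z + of_real pi)) (5 * \<tau>) = - theta1 (5 * z) (5 * \<tau>)"
    using theta1_plus_of_nat_pi[OF Im_5_mult_pos, of "5 * z" 5] by (simp add: distrib_left)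
  moreover have "f (z + of_real pi) = f z"
    using assms by simp
  ultimately show ?thesis
    by (simp add: res_kernel_def theta1_plus_pi[OF tau])
qed

text \<open>With \<open>k\<close> and \<open>x\<close> as below, numerator and denominator both
  acquire the factor \<open>- (k ^ 9 * x ^ 9)\<close>, as \<open>8 + 1 = 4 + 5\<close>. A common
  nonzero factor cancels even where the denominator is 0, so the equation also holds at the poles,
  as \<open>sum_residues_eq_0\<close> asks.\<close>

lemma res_kernel_plus_pi_tau:
  assumes "\<forall>z. f z = qpow 4 \<tau> * exp (16 * \<i> * z) * f (z + of_real pi * \<tau>)"
  shows "res_kernel (z + of_real pi * \<tau>) = res_kernel z"
proof -
  define x where "x = exp (- 2 * \<i> * z)"
  define k where "k = qpow (- 1 / 2) \<tau>"
  have nz: "x \<noteq> 0" "k \<noteq> 0" by (simp_all add: x_def k_def)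
  have k8: "qpow 4 \<tau> * k ^ 8 = 1"
    unfolding k_def qpow_of_nat_mult[of 8, symmetric] qpow_add[symmetric] by (simp add: qpow_def)
  have x8: "exp (16 * \<i> * z) * x ^ 8 = 1"
    unfolding x_def exp_of_nat_mult[symmetric] exp_add[symmetric] by simp
  have x2: "exp (- 2 * \<i> * (2 * z)) = x\<^sup>2" "exp (- 2 * \<i> * (5 * z)) = x ^ 5"
    unfolding x_def exp_of_nat_mult[symmetric] by simp_all
  have "exp (- 2 * \<i> * (2 * z + of_real pi * \<tau>)) = exp (- 2 * \<i> * (2 * z)) * qpow (- 1) \<tau>"
    by (simp add: qpow_def algebra_simps flip: exp_add)
  also have "qpow (- 1) \<tau> = k\<^sup>2"
    using qpow_of_nat_mult[of 2 "- 1 / 2" \<tau>] by (simp add: k_def)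
  finally have x3: "exp (- 2 * \<i> * (2 * z + of_real pi * \<tau>)) = x\<^sup>2 * k\<^sup>2"
    unfolding x2 .
  have k5: "qpow (- 1 / 2) (5 * \<tau>) = k ^ 5"
    using qpow_scale[of "- 1 / 2" 5 \<tau>] qpow_of_nat_mult[of 5 "- 1 / 2" \<tau>] by (simp add: k_def)
  have "theta1 (2 * (z + of_real pi * \<tau>)) \<tau> = theta1 (2 * z + of_real pi * \<tau> + of_real pi * \<tau>) \<tau>"
    by (simp add: algebra_simps)
  then have t2: "theta1 (2 * (z + of_real pi * \<tau>)) \<tau> = k ^ 4 * x ^ 4 * theta1 (2 * z) \<tau>"
    unfolding theta1_plus_pi_tau[OF tau] x3 x2 k_def[symmetric] by (simp add: numeral_eq_Suc)
  have "theta1 (5 * (z + of_real pi * \<tau>)) (5 * \<tau>) = theta1 (5 * z + of_real pi * (5 * \<tau>)) (5 * \<tau>)"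
    by (simp add: algebra_simps)
  then have t5: "theta1 (5 * (z + of_real pi * \<tau>)) (5 * \<tau>) = - (k ^ 5 * x ^ 5) * theta1 (5 * z) (5 * \<tau>)"
    unfolding theta1_plus_pi_tau[OF Im_5_mult_pos] x2 k5 by simp
  have t1: "theta1 (z + of_real pi * \<tau>) \<tau> = - k * x * theta1 z \<tau>"
    unfolding theta1_plus_pi_tau[OF tau] x_def k_def ..
  have "f z * k ^ 8 * x ^ 8 = (qpow 4 \<tau> * k ^ 8) * (exp (16 * \<i> * z) * x ^ 8) * f (z + of_real pi * \<tau>)"
    using assms[rule_format, of z] by simp
  then have ff: "f (z + of_real pi * \<tau>) = f z * k ^ 8 * x ^ 8"
    unfolding k8 x8 by simp
  have "f z * k ^ 8 * x ^ 8 * (- k * x * theta1 z \<tau>) = (- (k ^ 9 * x ^ 9)) * (f z * theta1 z \<tau>)"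
    by (simp add: numeral_eq_Suc)
  moreover have "k ^ 4 * x ^ 4 * theta1 (2 * z) \<tau> * (- (k ^ 5 * x ^ 5) * theta1 (5 * z) (5 * \<tau>)) =
      (- (k ^ 9 * x ^ 9)) * (theta1 (2 * z) \<tau> * theta1 (5 * z) (5 * \<tau>))"
    by (simp add: numeral_eq_Suc)
  ultimately show ?thesis
    unfolding res_kernel_def t1 t2 t5 ff using nz by (simp only:) simp
qed

end

section \<open>Evaluation of the residue sum\<close>

theorem theorem7p1:
  fixes \<tau> :: complex and f :: "complex \<Rightarrow> complex"
  assumes tau: "Im \<tau> > 0"
    and entire: "f holomorphic_on UNIV"
    and even: "\<forall>z. f (- z) = f z"
    and period_pi: "\<forall>z. f z = f (z + of_real pi)"
    and period_pi_tau: "\<forall>z. f z = qpow 4 \<tau> * exp (16 * \<i> * z) * f (z + of_real pi * \<tau>)"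
  shows "4 * f (2 * of_real pi / 5) / (theta1 (of_real pi / 5) \<tau>)\<^sup>2
       - 4 * f (of_real pi / 5) / (theta1 (2 * of_real pi / 5) \<tau>)\<^sup>2
     = of_real (sqrt 5) * (dedekind_eta (5 * \<tau>))\<^sup>2 / (dedekind_eta \<tau>) ^ 4 *
        (- f 0 * (dedekind_eta \<tau>) ^ 3 / (5 * (dedekind_eta (5 * \<tau>)) ^ 3)
         + f (of_real pi / 2) * vartheta2 \<tau> / vartheta2 (5 * \<tau>)
         - qpow 1 \<tau> * f ((of_real pi + of_real pi * \<tau>) / 2) * vartheta3 \<tau> / vartheta3 (5 * \<tau>)
         + qpow 1 \<tau> * f (of_real pi * \<tau> / 2) * vartheta4 \<tau> / vartheta4 (5 * \<tau>))"
proof -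
  let ?pi = "complex_of_real pi"
  define g where "g = res_kernel \<tau> f"
  define pt where "pt = (\<lambda>(a, b). of_real a * ?pi + of_real b * (?pi * \<tau>))"
  \<comment> \<open>Coordinates with respect to \<open>pi\<close> and \<open>pi * \<tau>\<close> of
    one pole per lattice class; \<open>(0, 0)\<close> belongs to both families. Real coordinates in
    \<open>[0, 1)\<close> reduce incongruence to differences of absolute value below 1.\<close>
  define I :: "(real \<times> real) set" where
    "I = {(0, 0), (1/2, 0), (0, 1/2), (1/2, 1/2), (1/5, 0), (2/5, 0), (3/5, 0), (4/5, 0)}"
  define r where "r p = Lim (at p) (\<lambda>z. (z - p) * g z)" for p
  have tau': "Im (5 * \<tau>) > 0" using tau by simp
  have nzE: "dedekind_eta \<tau> \<noteq> 0" "dedekind_eta (5 * \<tau>) \<noteq> 0"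
    using tau by (auto intro!: dedekind_eta_nonzero)
  have cong: "x = y" if "x \<in> I" "y \<in> I" "theta1 (pt x - pt y) \<tau> = 0" for x y
  proof -
    obtain a b c d where xy: "x = (a, b)" "y = (c, d)" by force
    have "pt x - pt y = of_real (a - c) * ?pi + of_real (b - d) * (?pi * \<tau>)"
      by (simp add: xy pt_def algebra_simps)
    with that(3) have "a - c \<in> \<int>" "b - d \<in> \<int>"
      by (simp_all only: theta1_lattice_coordinates_eq_0_iff[OF tau])
    moreover have "\<bar>a - c\<bar> < 1" "\<bar>b - d\<bar> < 1"
      using that(1,2) by (auto simp: xy I_def)
    ultimately have "a - c = 0" "b - d = 0"
      by (blast intro: Ints_nonzero_abs_less1)+
    then show ?thesis by (simp add: xy)
  qed
  have inj: "inj_on pt I"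
    by (rule inj_onI, rule cong) auto
  have on_P: "\<exists>p\<in>pt ` I. theta1 (z - p) \<tau> = 0"
    if "theta1 (2 * z) \<tau> = 0 \<or> theta1 (5 * z) (5 * \<tau>) = 0" for z
    using that
  proof
    assume "theta1 (2 * z) \<tau> = 0"
    then obtain m n :: int where mn: "2 * z = of_int m * ?pi + of_int n * ?pi * \<tau>"
      using theta1_eq_0_iff[OF tau] by blast
    have half: "of_int k = 2 * of_int (k div 2) + (of_int (k mod 2) :: complex)" for k :: int
      by (metis mult_div_mod_eq of_int_add of_int_mult of_int_numeral)
    \<comment> \<open>The parities of \<open>m\<close> and \<open>n\<close> select the half period,
      and the quotients by 2 give the lattice translation. The fifths below are treated likewise
      with remainders modulo 5.\<close>
    define i j where "i = m mod 2" and "j = n mod 2"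
    define x :: "real \<times> real" where "x = (of_int i / 2, of_int j / 2)"
    have "i = 0 \<or> i = 1" "j = 0 \<or> j = 1"
      unfolding i_def j_def by presburger+
    then have "x \<in> I"
      by (elim disjE) (simp_all add: x_def I_def)
    moreover have "z - pt x = of_int (m div 2) * ?pi + of_int (n div 2) * ?pi * \<tau>"
      using mn unfolding half[of m] half[of n] i_def[symmetric] j_def[symmetric]
      by (simp add: x_def pt_def field_simps)
    ultimately show ?thesis
      using theta1_eq_0_iff[OF tau] by blast
  next
    assume "theta1 (5 * z) (5 * \<tau>) = 0"
    then obtain m n :: int where mn: "5 * z = of_int m * ?pi + of_int n * ?pi * (5 * \<tau>)"
      using theta1_eq_0_iff[OF tau'] by blast
    have fifth: "of_int m = 5 * of_int (m div 5) + (of_int (m mod 5) :: complex)"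
      by (metis mult_div_mod_eq of_int_add of_int_mult of_int_numeral)
    define i where "i = m mod 5"
    define x :: "real \<times> real" where "x = (of_int i / 5, 0)"
    have "i = 0 \<or> i = 1 \<or> i = 2 \<or> i = 3 \<or> i = 4"
      unfolding i_def by presburger
    then have "x \<in> I"
      by (elim disjE) (simp_all add: x_def I_def)
    moreover have "z - pt x = of_int (m div 5) * ?pi + of_int n * ?pi * \<tau>"
      using mn unfolding fifth i_def[symmetric] by (simp add: x_def pt_def field_simps)
    ultimately show ?thesis
      using theta1_eq_0_iff[OF tau] by blast
  qed
  have nz: "theta1 (of_real a * ?pi + of_real b * (?pi * \<sigma>)) \<sigma> \<noteq> 0"
    if "0 < a \<and> a < 1 \<or> 0 < b \<and> b < 1" "Im \<sigma> > 0" for a b \<sigma>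
    using that by (auto simp: theta1_lattice_coordinates_eq_0_iff not_Ints_between_0_1)

  note r_0 = res_kernel_residue_0[OF tau entire, folded g_def]
  note r_half = res_kernel_residue_half_period[OF tau entire, folded g_def]
  note r_fifth = res_kernel_residue_fifth[OF tau entire, folded g_def]

  have p2: "theta1 (5 * (?pi / 2)) (5 * \<tau>) = vartheta2 (5 * \<tau>)"
    using theta1_plus_of_nat_pi[OF tau', of "?pi / 2" 2] by (simp add: theta1_half_pi)
  have nz2: "vartheta2 (5 * \<tau>) \<noteq> 0"
    using nz[of "1/2" 0 "5 * \<tau>"] tau' by (simp add: theta1_half_pi)
  have h2: "((\<lambda>z. (z - ?pi / 2) * g z) \<longlongrightarrow>
      f (?pi / 2) * vartheta2 \<tau> / (- 1 * (4 * dedekind_eta \<tau> ^ 3) * vartheta2 (5 * \<tau>))) (at (?pi / 2))"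
    using r_half[of "?pi / 2" "\<lambda>_. - 1"] nz2
    unfolding p2 theta1_half_pi by (simp add: theta1_plus_pi[OF tau])
  \<comment> \<open>Origin of the factor \<open>q\<close> in the claim: \<open>- 1 / 2\<close> comes
    from the multiplier \<open>M\<close>, the two \<open>- 1 / 8\<close> from the theta values at
    \<open>5 * \<tau>\<close> and \<open>\<tau>\<close>, and
    \<open>- 1 / 2 - 5 / 8 + 1 = - 1 / 8\<close>.\<close>
  have k: "qpow (- 1 / 2) \<tau> * qpow (- 1 / 8) (5 * \<tau>) * qpow 1 \<tau> = qpow (- 1 / 8) \<tau>"
    using qpow_scale[of "- 1 / 8" 5 \<tau>] by (simp flip: qpow_add)
  have p4: "theta1 (5 * (?pi * \<tau> / 2)) (5 * \<tau>) = \<i> * qpow (- 1 / 8) (5 * \<tau>) * vartheta4 (5 * \<tau>)"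
    using theta1_half_pi_tau[OF tau'] by (simp add: mult_ac)
  have nz4: "vartheta4 (5 * \<tau>) \<noteq> 0"
    using nz[of 0 "1/2" "5 * \<tau>"] tau' theta1_half_pi_tau[OF tau'] by auto
  have h4: "((\<lambda>z. (z - ?pi * \<tau> / 2) * g z) \<longlongrightarrow>
      - (qpow 1 \<tau> * f (?pi * \<tau> / 2) * vartheta4 \<tau> / (4 * dedekind_eta \<tau> ^ 3 * vartheta4 (5 * \<tau>)))) (at (?pi * \<tau> / 2))"
  proof -
    have "((\<lambda>z. (z - ?pi * \<tau> / 2) * g z) \<longlongrightarrow>
      f (?pi * \<tau> / 2) * (\<i> * qpow (- 1 / 8) \<tau> * vartheta4 \<tau>) / ((- qpow (- 1 / 2) \<tau>) * (4 * dedekind_eta \<tau> ^ 3) *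
        (\<i> * qpow (- 1 / 8) (5 * \<tau>) * vartheta4 (5 * \<tau>)))) (at (?pi * \<tau> / 2))"
      using r_half[of "?pi * \<tau> / 2" "\<lambda>u. - qpow (- 1 / 2) \<tau> * exp (- 2 * \<i> * (2 * u))"] nz4
      unfolding p4 theta1_half_pi_tau[OF tau] by (simp add: theta1_plus_pi_tau[OF tau])
    then show ?thesis
      unfolding k[symmetric] using nzE nz4 by (simp add: field_simps)
  qed
  have p3: "theta1 (5 * ((?pi + ?pi * \<tau>) / 2)) (5 * \<tau>) = qpow (- 1 / 8) (5 * \<tau>) * vartheta3 (5 * \<tau>)"
  proof -
    have "5 * ((?pi + ?pi * \<tau>) / 2) = (?pi + ?pi * (5 * \<tau>)) / 2 + of_nat 2 * ?pi"
      by (simp add: field_simps)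
    then show ?thesis
      by (simp only: theta1_plus_of_nat_pi[OF tau'] theta1_half_pi_pi_tau[OF tau']) simp
  qed
  have nz3: "vartheta3 (5 * \<tau>) \<noteq> 0"
    using nz[of "1/2" "1/2" "5 * \<tau>"] tau' theta1_half_pi_pi_tau[OF tau'] by (auto simp: add_divide_distrib)
  have h3: "((\<lambda>z. (z - (?pi + ?pi * \<tau>) / 2) * g z) \<longlongrightarrow>
      qpow 1 \<tau> * f ((?pi + ?pi * \<tau>) / 2) * vartheta3 \<tau> / (4 * dedekind_eta \<tau> ^ 3 * vartheta3 (5 * \<tau>))) (at ((?pi + ?pi * \<tau>) / 2))"
  proof -
    \<comment> \<open>The translation is by \<open>pi + pi * \<tau>\<close>, and the two minus signs
      cancel; this accounts for the sign of the \<open>vartheta3\<close> term.\<close>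
    have M: "theta1 (2 * u + 2 * ((?pi + ?pi * \<tau>) / 2)) \<tau> = qpow (- 1 / 2) \<tau> * exp (- 2 * \<i> * (2 * u)) * theta1 (2 * u) \<tau>" for u
    proof -
      have "2 * u + 2 * ((?pi + ?pi * \<tau>) / 2) = (2 * u + ?pi * \<tau>) + ?pi"
        by (simp add: field_simps)
      then show ?thesis
        by (simp only: theta1_plus_pi[OF tau] theta1_plus_pi_tau[OF tau]) simp
    qed
    have "((\<lambda>z. (z - (?pi + ?pi * \<tau>) / 2) * g z) \<longlongrightarrow>
      f ((?pi + ?pi * \<tau>) / 2) * (qpow (- 1 / 8) \<tau> * vartheta3 \<tau>) / (qpow (- 1 / 2) \<tau> * (4 * dedekind_eta \<tau> ^ 3) *
        (qpow (- 1 / 8) (5 * \<tau>) * vartheta3 (5 * \<tau>)))) (at ((?pi + ?pi * \<tau>) / 2))"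
      using r_half[OF M] nz3
      unfolding p3 theta1_half_pi_pi_tau[OF tau] by simp
    then show ?thesis
      unfolding k[symmetric] using nzE nz3 by (simp add: field_simps)
  qed
  define a where "a = theta1 (?pi / 5) \<tau>"
  define b where "b = theta1 (2 * ?pi / 5) \<tau>"
  define E5 where "E5 = dedekind_eta (5 * \<tau>) ^ 3"
  have nza: "a \<noteq> 0" and nzb: "b \<noteq> 0"
    using nz[of "1/5" 0 \<tau>] nz[of "2/5" 0 \<tau>] tau by (auto simp: a_def b_def)
  have th: "theta1 (4 * ?pi / 5) \<tau> = a" "theta1 (3 * ?pi / 5) \<tau> = b" "theta1 (6 * ?pi / 5) \<tau> = - a" "theta1 (8 * ?pi / 5) \<tau> = - b"
  proof -
    have refl: "theta1 (?pi - w) \<tau> = theta1 w \<tau>" for w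
      using theta1_plus_pi[OF tau, of "- w"] by (simp add: theta1_minus[OF tau])
    have "4 * ?pi / 5 = ?pi - ?pi / 5" "3 * ?pi / 5 = ?pi - 2 * ?pi / 5"
      "6 * ?pi / 5 = ?pi / 5 + ?pi" "8 * ?pi / 5 = (?pi - 2 * ?pi / 5) + ?pi"
      by (simp_all add: field_simps)
    then show "theta1 (4 * ?pi / 5) \<tau> = a" "theta1 (3 * ?pi / 5) \<tau> = b" "theta1 (6 * ?pi / 5) \<tau> = - a" "theta1 (8 * ?pi / 5) \<tau> = - b"
      by (simp_all only: theta1_plus_pi[OF tau] refl a_def b_def)
  qed
  have ff: "f (4 * ?pi / 5) = f (?pi / 5)" "f (3 * ?pi / 5) = f (2 * ?pi / 5)"
  proof -
    have refl: "f (?pi - w) = f w" for w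
      using period_pi[rule_format, of "- w"] even by simp
    have "4 * ?pi / 5 = ?pi - ?pi / 5" "3 * ?pi / 5 = ?pi - 2 * ?pi / 5"
      by (simp_all add: field_simps)
    then show "f (4 * ?pi / 5) = f (?pi / 5)" "f (3 * ?pi / 5) = f (2 * ?pi / 5)"
      by (simp_all only: refl)
  qed
  have f1: "((\<lambda>z. (z - ?pi / 5) * g z) \<longlongrightarrow> - (f (?pi / 5) * a / (b * (10 * E5)))) (at (?pi / 5))"
    using r_fifth[of "?pi / 5" 1] nzb by (simp add: a_def[symmetric] b_def[symmetric] E5_def[symmetric])
  have f2: "((\<lambda>z. (z - 2 * ?pi / 5) * g z) \<longlongrightarrow> f (2 * ?pi / 5) * b / (a * (10 * E5))) (at (2 * ?pi / 5))"
    using r_fifth[of "2 * ?pi / 5" 2] nza by (simp add: th b_def[symmetric] E5_def[symmetric])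
  have f3: "((\<lambda>z. (z - 3 * ?pi / 5) * g z) \<longlongrightarrow> f (2 * ?pi / 5) * b / (a * (10 * E5))) (at (3 * ?pi / 5))"
    using r_fifth[of "3 * ?pi / 5" 3] nza by (simp add: th ff E5_def[symmetric])
  have f4: "((\<lambda>z. (z - 4 * ?pi / 5) * g z) \<longlongrightarrow> - (f (?pi / 5) * a / (b * (10 * E5)))) (at (4 * ?pi / 5))"
    using r_fifth[of "4 * ?pi / 5" 4] nzb by (simp add: th ff E5_def[symmetric])

  have pt: "pt (0, 0) = 0" "pt (1/2, 0) = ?pi / 2" "pt (0, 1/2) = ?pi * \<tau> / 2" "pt (1/2, 1/2) = (?pi + ?pi * \<tau>) / 2"
    "pt (1/5, 0) = ?pi / 5" "pt (2/5, 0) = 2 * ?pi / 5" "pt (3/5, 0) = 3 * ?pi / 5" "pt (4/5, 0) = 4 * ?pi / 5"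
    by (simp_all add: pt_def add_divide_distrib)
  have lim: "((\<lambda>z. (z - p) * g z) \<longlongrightarrow> r p) (at p)" if "p \<in> pt ` I" for p
  proof -
    \<comment> \<open>Existence of the limits is enough here, because \<open>r\<close> is defined
      through \<open>Lim\<close>; the values enter later, in \<open>sum0\<close>.\<close>
    have "\<exists>l. ((\<lambda>z. (z - p) * g z) \<longlongrightarrow> l) (at p)"
      using that unfolding I_def image_insert image_empty pt
      by (elim insertE emptyE; hypsubst) (use r_0 h2 h3 h4 f1 f2 f3 f4 in \<open>blast+\<close>)
    then show ?thesis
      unfolding r_def using tendsto_Lim[OF at_neq_bot] by metis
  qed
  have "(\<Sum>p\<in>pt ` I. r p) = 0"
  proof (rule sum_residues_eq_0[OF tau, where g = g])
    show "finite (pt ` I)" by (simp add: I_def)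
    show "p = p'" if "p \<in> pt ` I" "p' \<in> pt ` I" "theta1 (p - p') \<tau> = 0" for p p'
      using that cong by blast
    show "g holomorphic_on {z. \<forall>p\<in>pt ` I. theta1 (z - p) \<tau> \<noteq> 0}"
      unfolding g_def using on_P by (intro holomorphic_res_kernel[OF tau entire]) auto
    show "g (z + ?pi) = g z" for z
      unfolding g_def using period_pi by (rule res_kernel_plus_pi[OF tau entire])
    show "g (z + ?pi * \<tau>) = g z" for z
      unfolding g_def using period_pi_tau by (rule res_kernel_plus_pi_tau[OF tau entire])
  qed (rule lim)
  then have "(\<Sum>x\<in>I. r (pt x)) = 0"
    using inj by (simp add: sum.reindex)
  then have sum_r: "r 0 + (r (?pi / 2) + (r (?pi * \<tau> / 2) + (r ((?pi + ?pi * \<tau>) / 2) + (r (?pi / 5) + (r (2 * ?pi / 5) + (r (3 * ?pi / 5) + r (4 * ?pi / 5))))))) = 0"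
    by (simp add: I_def pt)
  have Lim: "r p = l" if "((\<lambda>z. (z - p) * g z) \<longlongrightarrow> l) (at p)" for p l
    unfolding r_def using that by (rule tendsto_Lim[OF at_neq_bot])
  have sum0: "f 0 / (20 * E5) + (f (?pi / 2) * vartheta2 \<tau> / (- 1 * (4 * dedekind_eta \<tau> ^ 3) * vartheta2 (5 * \<tau>)) +
     (- (qpow 1 \<tau> * f (?pi * \<tau> / 2) * vartheta4 \<tau> / (4 * dedekind_eta \<tau> ^ 3 * vartheta4 (5 * \<tau>))) +
     (qpow 1 \<tau> * f ((?pi + ?pi * \<tau>) / 2) * vartheta3 \<tau> / (4 * dedekind_eta \<tau> ^ 3 * vartheta3 (5 * \<tau>)) +
     (- (f (?pi / 5) * a / (b * (10 * E5))) + (f (2 * ?pi / 5) * b / (a * (10 * E5)) +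
     (f (2 * ?pi / 5) * b / (a * (10 * E5)) + - (f (?pi / 5) * a / (b * (10 * E5))))))))) = 0"
    using sum_r unfolding Lim[OF r_0, folded E5_def] Lim[OF h2] Lim[OF h3] Lim[OF h4] Lim[OF f1] Lim[OF f2] Lim[OF f3] Lim[OF f4] .
  define T where "T = - f 0 * dedekind_eta \<tau> ^ 3 / (5 * dedekind_eta (5 * \<tau>) ^ 3)
      + f (?pi / 2) * vartheta2 \<tau> / vartheta2 (5 * \<tau>)
      - qpow 1 \<tau> * f ((?pi + ?pi * \<tau>) / 2) * vartheta3 \<tau> / vartheta3 (5 * \<tau>)
      + qpow 1 \<tau> * f (?pi * \<tau> / 2) * vartheta4 \<tau> / vartheta4 (5 * \<tau>)"
  \<comment> \<open>The equal residues at \<open>k\<close> and \<open>5 - k\<close> fifths of pi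
    double up, so the four of them sum to \<open>D / (5 * E5)\<close>. The other four sum to
    \<open>- T / (4 * dedekind_eta \<tau> ^ 3)\<close>.\<close>
  define D where "D = f (2 * ?pi / 5) * b / a - f (?pi / 5) * a / b"
  have nzE5: "E5 \<noteq> 0" using nzE by (simp add: E5_def)
  have "D / (5 * E5) - T / (4 * dedekind_eta \<tau> ^ 3) = 0"
  proof -
    have e1: "D / (5 * E5) = 2 * (f (2 * ?pi / 5) * b / (a * (10 * E5))) - 2 * (f (?pi / 5) * a / (b * (10 * E5)))"
      using nza nzb nzE5 by (simp add: D_def field_simps)
    have e2: "T / (4 * dedekind_eta \<tau> ^ 3) = - (f 0 / (20 * E5))
      + f (?pi / 2) * vartheta2 \<tau> / (4 * dedekind_eta \<tau> ^ 3 * vartheta2 (5 * \<tau>))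
      - qpow 1 \<tau> * f ((?pi + ?pi * \<tau>) / 2) * vartheta3 \<tau> / (4 * dedekind_eta \<tau> ^ 3 * vartheta3 (5 * \<tau>))
      + qpow 1 \<tau> * f (?pi * \<tau> / 2) * vartheta4 \<tau> / (4 * dedekind_eta \<tau> ^ 3 * vartheta4 (5 * \<tau>))"
      using nzE unfolding T_def E5_def add_divide_distrib diff_divide_distrib by (simp add: mult_ac)
    show ?thesis
      unfolding e1 e2 using sum0 by (simp add: algebra_simps)
  qed
  then have D: "D = 5 * E5 * T / (4 * dedekind_eta \<tau> ^ 3)"
    using nzE5 by (simp add: field_simps)
  have ab: "a * b = of_real (sqrt 5) * dedekind_eta \<tau> * dedekind_eta (5 * \<tau>)"
    unfolding a_def b_def by (rule theta1_fifths[OF tau])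
  \<comment> \<open>Division by \<open>a * b\<close> turns the quotients \<open>b / a\<close> and
    \<open>a / b\<close> in \<open>D\<close> into the inverse squares of the claim, and brings in
    \<open>theta1_fifths\<close>.\<close>
  have "4 * f (2 * ?pi / 5) / a\<^sup>2 - 4 * f (?pi / 5) / b\<^sup>2 = 4 * D / (a * b)"
    using nza nzb by (simp add: D_def field_simps power2_eq_square)
  also have "\<dots> = of_real (sqrt 5) * (dedekind_eta (5 * \<tau>))\<^sup>2 / dedekind_eta \<tau> ^ 4 * T"
  proof -
    \<comment> \<open>The 5 from the scaling of \<open>theta1 (5 * z) (5 * \<tau>)\<close> is split
      so that one root cancels against the root in \<open>a * b\<close>.\<close>
    have s5: "(5 :: complex) = of_real (sqrt 5) * of_real (sqrt 5)"
      by (simp flip: of_real_mult)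
    define s where "s = complex_of_real (sqrt 5)"
    have "s \<noteq> 0" by (simp add: s_def)
    then show ?thesis
      unfolding D ab E5_def s_def[symmetric] s5[folded s_def]
      using nzE by (simp add: field_simps power2_eq_square power3_eq_cube numeral_eq_Suc)
  qed
  finally show ?thesis
    unfolding a_def b_def T_def .
qed

end
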